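(* The problem of interdicting the maximum cardinality stable set in a bipartite graph can be solved efficiently. That is, there is a polynomial-time algorithm that, given a bipartite graph $G=(V,E)$, interdiction costs $c:V\to\mathbb{Z}_{>0}$ and a budget $B\in\mathbb{Z}_{>0}$, computes a set $R\subseteq V$ with $c(R)\le B$ minimizing $\alpha(G[V\setminus R])$ among all such sets.
   Context: $\alpha(H)$ is the maximum cardinality of a stable (independent) set of vertices in a graph $H$, $G[W]$ is the subgraph of $G$ induced by $W\subseteq V$, and $c(R)=\sum_{v\in R}c(v)$. *)

theory Defs
  imports "HOL-Library.Log_Nat" "HOL-Computational_Algebra.Polynomial"
begin

section \<open>Graphs, stable sets and interdiction\<close>

definition simple_graph :: "'a set \<Rightarrow> 'a set set \<Rightarrow> bool" where
  "simple_graph V E \<longleftrightarrow> finite V \<and> (\<forall>e\<in>E. e \<subseteq> V \<and> card e = 2)"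

definition bipartite :: "'a set \<Rightarrow> 'a set set \<Rightarrow> bool" where
  "bipartite V E \<longleftrightarrow>
     simple_graph V E \<and>
     (\<exists>X Y. X \<union> Y = V \<and> X \<inter> Y = {} \<and> (\<forall>e\<in>E. \<exists>x\<in>X. \<exists>y\<in>Y. e = {x, y}))"

definition induced_edges :: "'a set set \<Rightarrow> 'a set \<Rightarrow> 'a set set" where
  "induced_edges E W = {e \<in> E. e \<subseteq> W}"

definition stable_set :: "'a set \<Rightarrow> 'a set set \<Rightarrow> 'a set \<Rightarrow> bool" where
  "stable_set V E S \<longleftrightarrow> S \<subseteq> V \<and> (\<forall>e\<in>E. \<not> e \<subseteq> S)"

definition stability_number :: "'a set \<Rightarrow> 'a set set \<Rightarrow> nat" where
  "stability_number V E = Max (card ` {S. stable_set V E S})"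

definition interdiction_set :: "'a set \<Rightarrow> ('a \<Rightarrow> nat) \<Rightarrow> nat \<Rightarrow> 'a set \<Rightarrow> bool" where
  "interdiction_set V c B R \<longleftrightarrow> R \<subseteq> V \<and> (\<Sum>v\<in>R. c v) \<le> B"

definition optimal_interdiction_set ::
    "'a set \<Rightarrow> 'a set set \<Rightarrow> ('a \<Rightarrow> nat) \<Rightarrow> nat \<Rightarrow> 'a set \<Rightarrow> bool" where
  "optimal_interdiction_set V E c B R \<longleftrightarrow>
     interdiction_set V c B R \<and>
     (\<forall>R'. interdiction_set V c B R' \<longrightarrow>
        stability_number (V - R) (induced_edges E (V - R))
          \<le> stability_number (V - R') (induced_edges E (V - R')))"


section \<open>Random access machines with logarithmic cost\<close>

text \<open>
  The model of computation is a random access machine, programmed in a structured language, whose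
  memory is divided into arrays of natural numbers (a program mentions only finitely many of them;
  a scalar variable is cell 0 of an array). Time is the logarithmic cost: every operation is
  charged the binary lengths of all numbers and addresses it involves, so that running times agree
  with those of Turing machines up to a polynomial.
\<close>

type_synonym store = "string \<Rightarrow> nat \<Rightarrow> nat"

datatype aexp = Const nat | Read string aexp | Add aexp aexp | Sub aexp aexp

datatype bexp = Less aexp aexp | Not bexp | And bexp bexp

datatype com = Skip | Write string aexp aexp | Seq com com | If bexp com com | While bexp com

text \<open>The number of binary digits of a number, where 0 has one digit.\<close>

definition bin_length :: "nat \<Rightarrow> nat" where
  "bin_length n = max 1 (floorlog 2 n)"

text \<open>Subtraction is truncated at 0.\<close>

fun aval :: "aexp \<Rightarrow> store \<Rightarrow> nat" where
  "aval (Const n) s = n"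
| "aval (Read x a) s = s x (aval a s)"
| "aval (Add a b) s = aval a s + aval b s"
| "aval (Sub a b) s = aval a s - aval b s"

text \<open>Each node of an expression is charged the length of its value; the lengths of the operands
  are charged at the nodes below it.\<close>

fun acost :: "aexp \<Rightarrow> store \<Rightarrow> nat" where
  "acost (Const n) s = bin_length n"
| "acost (Read x a) s = acost a s + bin_length (s x (aval a s))"
| "acost (Add a b) s = acost a s + acost b s + bin_length (aval a s + aval b s)"
| "acost (Sub a b) s = acost a s + acost b s + bin_length (aval a s - aval b s)"

fun bval :: "bexp \<Rightarrow> store \<Rightarrow> bool" where
  "bval (Less a b) s \<longleftrightarrow> aval a s < aval b s"
| "bval (Not b) s \<longleftrightarrow> \<not> bval b s"
| "bval (And b b') s \<longleftrightarrow> bval b s \<and> bval b' s"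

fun bcost :: "bexp \<Rightarrow> store \<Rightarrow> nat" where
  "bcost (Less a b) s = acost a s + acost b s + 1"
| "bcost (Not b) s = bcost b s + 1"
| "bcost (And b b') s = bcost b s + bcost b' s + 1"

text \<open>\<open>exec p s t s'\<close>: started in \<open>s\<close>, the program \<open>p\<close> halts after time \<open>t\<close> in \<open>s'\<close>.\<close>

inductive exec :: "com \<Rightarrow> store \<Rightarrow> nat \<Rightarrow> store \<Rightarrow> bool" where
  Skip: "exec Skip s 1 s"
| Write: "exec (Write x a b) s (acost a s + acost b s + 1)
            (s(x := (s x)(aval a s := aval b s)))"
| Seq: "exec p s t s' \<Longrightarrow> exec q s' t' s'' \<Longrightarrow> exec (Seq p q) s (t + t') s''"
| IfTrue: "bval b s \<Longrightarrow> exec p s t s' \<Longrightarrow> exec (If b p q) s (bcost b s + t) s'"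
| IfFalse: "\<not> bval b s \<Longrightarrow> exec q s t s' \<Longrightarrow> exec (If b p q) s (bcost b s + t) s'"
| WhileFalse: "\<not> bval b s \<Longrightarrow> exec (While b p) s (bcost b s) s"
| WhileTrue: "bval b s \<Longrightarrow> exec p s t s' \<Longrightarrow> exec (While b p) s' t' s'' \<Longrightarrow>
    exec (While b p) s (bcost b s + t + t') s''"

inductive_cases exec_SkipE: "exec Skip s t s'"
inductive_cases exec_WriteE: "exec (Write x a b) s t s'"
inductive_cases exec_SeqE: "exec (Seq p q) s t s'"
inductive_cases exec_IfE: "exec (If b p q) s t s'"
inductive_cases exec_WhileE: "exec (While b p) s t s'"

lemma exec_deterministic:
  assumes "exec p s t s'" "exec p s u s''"
  shows "t = u \<and> s' = s''"
  using assms
proof (induction arbitrary: u s'' rule: exec.induct)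
  case (Skip s)
  then show ?case by (auto elim: exec_SkipE)
next
  case (Write x a b s)
  then show ?case by (auto elim: exec_WriteE)
next
  case (Seq p s t s1 q t' s2)
  from Seq.prems show ?case by (rule exec_SeqE) (metis Seq.IH)
next
  case (IfTrue b s p t s' q)
  from IfTrue.prems show ?case by (rule exec_IfE) (use IfTrue in metis)+
next
  case (IfFalse b s q t s' p)
  from IfFalse.prems show ?case by (rule exec_IfE) (use IfFalse in metis)+
next
  case (WhileFalse b s p)
  then show ?case by (auto elim: exec_WhileE)
next
  case (WhileTrue b s p t s1 t' s2)
  from WhileTrue.prems show ?case by (rule exec_WhileE) (use WhileTrue in metis)+
qed

definition initial_store :: "nat list \<Rightarrow> store" where
  "initial_store xs = (\<lambda>x i.
     if x = ''in'' \<and> i < length xs then xs ! i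
     else if x = ''inlen'' \<and> i = 0 then length xs
     else 0)"

definition output_of :: "store \<Rightarrow> nat list" where
  "output_of s = map (s ''out'') [0..<s ''outlen'' 0]"

definition computes_in_time :: "com \<Rightarrow> nat list \<Rightarrow> nat list \<Rightarrow> nat \<Rightarrow> bool" where
  "computes_in_time p xs ys t \<longleftrightarrow> (\<exists>s. exec p (initial_store xs) t s \<and> output_of s = ys)"

definition input_size :: "nat list \<Rightarrow> nat" where
  "input_size xs = (\<Sum>x\<leftarrow>xs. bin_length x)"


section \<open>Encoding of instances\<close>

text \<open>
  The vertices of an input graph are numbered \<open>0, \<dots>, n - 1\<close>. An instance is presented as
  the number of vertices, the number of edges, the budget, the costs of the vertices, and a list
  of the edges in which every edge occurs once, with its end vertices in either order. No
  bipartition is part of the input.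
\<close>

definition encodes_instance ::
    "nat list \<Rightarrow> nat \<Rightarrow> nat set set \<Rightarrow> (nat \<Rightarrow> nat) \<Rightarrow> nat \<Rightarrow> bool" where
  "encodes_instance xs n E c B \<longleftrightarrow>
     (\<exists>es. distinct (map (\<lambda>(u, v). {u, v}) es) \<and> set (map (\<lambda>(u, v). {u, v}) es) = E \<and>
        xs = [n, length es, B] @ map c [0..<n] @ concat (map (\<lambda>(u, v). [u, v]) es))"

end

theory Submission
  imports Defs
begin

text \<open>
  Deleting \<open>R\<close> and matching \<open>M\<close> in the rest bounds the stability number by
  \<open>n - |R| - |M|\<close>, with equality for a maximum matching. Attach to every vertex a pendant vertex
  carrying its cost, and give the original vertices weight 0: then \<open>R\<close> together with \<open>M\<close> becomes
  a matching of the enlarged bipartite graph, \<open>c(R)\<close> is the weight of its covered vertices, and one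
  looks for the largest matching of weight at most \<open>B\<close>. Successive cheapest augmenting paths keep
  the matching optimal; as only the end vertices of a path become newly covered, its cost is the
  sum of two weights, and plain reachability replaces shortest paths.

  Optimality is certified by integral potentials for a Lagrange multiplier. At the end, the clamped
  potential is a scaled fractional stable set, and rounding it bounds the stability number left
  by every other affordable interdiction set from below.
\<close>

section \<open>A loop language with polynomial running time\<close>

text \<open>A budget on arbitrary costs looks like a knapsack constraint. What removes this obstacle
  is convexity: the least weight of a matching with k edges is a convex function of k, and a single
  augmentation leads from k to k + 1, so every size has an optimal matching certified by some
  multiplier. The Lagrangian bound can then be off by less than one unit of cardinality, and
  integrality absorbs that. If no augmenting path fits into the remaining budget r, the multiplier
  can be raised to some l > r, and counting with the fractional stable set gives l * \<alpha>(G - R)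
  < l * (\<alpha>(G - R') + 1) for each affordable R'.

  The bipartition, the multiplier and the potentials exist only in the correctness proof. The
  program searches, compares sums of two weights and subtracts from the budget, so its numbers never
  grow. All its loops run for the same number of rounds, with guards inside the bodies, so that the
  time bound can be read off the syntax.\<close>

datatype prog =
  Nop
| Asg string aexp aexp
| Then prog prog (infixr \<open>;;\<close> 60)
| Cond bexp prog prog
| For string prog

abbreviation cell :: "string \<Rightarrow> aexp" where
  "cell x \<equiv> Read x (Const 0)"

text \<open>Twice the input length bounds everything a loop has to cover: the \<open>2 * n\<close>
  vertices of the enlarged graph, its \<open>n + m\<close> edges, and the number of rounds after
  which a growing set of vertices must be stationary.\<close>

abbreviation loop_bound :: aexp where
  "loop_bound \<equiv> Add (cell ''inlen'') (cell ''inlen'')"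

fun compile :: "prog \<Rightarrow> com" where
  "compile Nop = Skip"
| "compile (Asg x a e) = Write x a e"
| "compile (Then p q) = Seq (compile p) (compile q)"
| "compile (Cond b p q) = If b (compile p) (compile q)"
| "compile (For x p) = Seq (Write x (Const 0) (Const 0))
     (While (Less (cell x) loop_bound)
       (Seq (compile p) (Write x (Const 0) (Add (cell x) (Const 1)))))"

definition set_cell :: "string \<Rightarrow> nat \<Rightarrow> store \<Rightarrow> store" where
  "set_cell x i s = s(x := (s x)(0 := i))"

text \<open>A total functional semantics is possible because the number of rounds of a loop is fixed
  on entry. Correctness is proved about \<open>run\<close> alone; \<open>run_exec\<close> connects
  it with timed execution once and for all.\<close>

fun run :: "prog \<Rightarrow> store \<Rightarrow> store" where
  "run Nop s = s"
| "run (Asg x a e) s = s(x := (s x)(aval a s := aval e s))"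
| "run (Then p q) s = run q (run p s)"
| "run (Cond b p q) s = (if bval b s then run p s else run q s)"
| "run (For x p) s =
     fold (\<lambda>i s. set_cell x (Suc i) (run p s)) [0..<2 * s ''inlen'' 0] (set_cell x 0 s)"

fun written :: "prog \<Rightarrow> string set" where
  "written Nop = {}"
| "written (Asg x a e) = {x}"
| "written (Then p q) = written p \<union> written q"
| "written (Cond b p q) = written p \<union> written q"
| "written (For x p) = insert x (written p)"

lemma run_frame: "x \<notin> written p \<Longrightarrow> run p s x = s x"
proof (induction p arbitrary: s)
  case (For y p)
  have "fold (\<lambda>i s. set_cell y (Suc i) (run p s)) is s x = s x" for "is" s
    using For by (induction "is" arbitrary: s) (auto simp: set_cell_def)
  then show ?case
    using For by (simp add: set_cell_def)
qed auto

text \<open>Sums may be used in addresses and comparisons but are not stored, so that no program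
  creates a number beyond those of the input and the loop counters.\<close>

fun sum_free :: "aexp \<Rightarrow> bool" where
  "sum_free (Const k) \<longleftrightarrow> k \<le> 1"
| "sum_free (Read x a) \<longleftrightarrow> True"
| "sum_free (Add a b) \<longleftrightarrow> False"
| "sum_free (Sub a b) \<longleftrightarrow> sum_free a"

fun well_formed :: "prog \<Rightarrow> bool" where
  "well_formed Nop \<longleftrightarrow> True"
| "well_formed (Asg x a e) \<longleftrightarrow> x \<noteq> ''inlen'' \<and> sum_free e"
| "well_formed (Then p q) \<longleftrightarrow> well_formed p \<and> well_formed q"
| "well_formed (Cond b p q) \<longleftrightarrow> well_formed p \<and> well_formed q"
| "well_formed (For x p) \<longleftrightarrow> x \<noteq> ''inlen'' \<and> x \<notin> written p \<and> well_formed p"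

fun growth :: "aexp \<Rightarrow> nat" where
  "growth (Const k) = Suc k"
| "growth (Read x a) = 1"
| "growth (Add a b) = growth a + growth b"
| "growth (Sub a b) = growth a"

section \<open>Polynomial bounds on the logarithmic cost\<close>

abbreviation size_var :: "nat poly" where
  "size_var \<equiv> [:0, 1:]"

fun aexp_poly :: "aexp \<Rightarrow> nat poly" where
  "aexp_poly (Const k) = [:growth (Const k) + 2, 1:]"
| "aexp_poly (Read x a) = aexp_poly a + [:3, 1:]"
| "aexp_poly (Add a b) = aexp_poly a + aexp_poly b + [:growth (Add a b) + 2, 1:]"
| "aexp_poly (Sub a b) = aexp_poly a + aexp_poly b + [:growth (Sub a b) + 2, 1:]"

fun bexp_poly :: "bexp \<Rightarrow> nat poly" where
  "bexp_poly (Less a b) = aexp_poly a + aexp_poly b + 1"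
| "bexp_poly (Not b) = bexp_poly b + 1"
| "bexp_poly (And b b') = bexp_poly b + bexp_poly b' + 1"

fun write_poly :: "aexp \<Rightarrow> aexp \<Rightarrow> nat poly" where
  "write_poly a e = aexp_poly a + aexp_poly e + 1"

text \<open>The variable of the polynomials stands for the input size z. The factor
  \<open>[:0, 2:]\<close> is the bound 2 * z on the rounds of a loop, and the two branches of a
  conditional are added because polynomials have no maximum.\<close>

fun time_poly :: "prog \<Rightarrow> nat poly" where
  "time_poly Nop = 1"
| "time_poly (Asg x a e) = write_poly a e"
| "time_poly (Then p q) = time_poly p + time_poly q"
| "time_poly (Cond b p q) = bexp_poly b + time_poly p + time_poly q"
| "time_poly (For x p) = write_poly (Const 0) (Const 0) + bexp_poly (Less (cell x) loop_bound)
     + [:0, 2:] * (bexp_poly (Less (cell x) loop_bound) + time_poly p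
         + write_poly (Const 0) (Add (cell x) (Const 1)))"

lemma bin_length_le:
  assumes "k < 2 ^ l" "l > 0"
  shows "bin_length k \<le> l"
  using assms by (simp add: bin_length_def floorlog_le_iff)

lemma less_two_power_bin_length: "k < 2 ^ bin_length k"
proof -
  have "k < 2 ^ floorlog 2 k"
    using floorlog_bounds[of k 2] by (cases "k = 0") auto
  also have "\<dots> \<le> 2 ^ bin_length k"
    by (simp add: bin_length_def)
  finally show ?thesis .
qed

text \<open>The exponent \<open>Suc z\<close> makes room for the loop counters, which climb to
  \<open>2 * inlen\<close> and hence at most to 2 * z; the numbers of the input lie below 2 ^
  z.\<close>

definition store_bounded :: "nat \<Rightarrow> store \<Rightarrow> bool" where
  "store_bounded z s \<longleftrightarrow> (\<forall>x i. s x i \<le> 2 ^ Suc z)"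

lemma store_boundedD: "store_bounded z s \<Longrightarrow> s x i \<le> 2 ^ Suc z"
  by (simp add: store_bounded_def)

lemma aval_le_growth:
  assumes "store_bounded z s"
  shows "aval a s \<le> growth a * 2 ^ Suc z"
proof (induction a)
  case (Const k)
  have "k * 1 \<le> Suc k * 2 ^ Suc z"
    by (intro mult_le_mono) auto
  then show ?case by simp
next
  case (Read x a)
  then show ?case using store_boundedD[OF assms] by simp
next
  case (Add a b)
  then show ?case by (simp add: algebra_simps)
next
  case (Sub a b)
  then show ?case by (simp add: le_diff_conv trans_le_add1)
qed

lemma bin_length_aval:
  assumes "store_bounded z s"
  shows "bin_length (aval a s) \<le> growth a + 2 + z"
proof (rule bin_length_le)
  have "growth a * 2 ^ Suc z < 2 ^ growth a * 2 ^ Suc z"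
    by (simp add: less_exp)
  also have "\<dots> \<le> 2 ^ (growth a + 2 + z)"
    by (simp add: power_add)
  finally show "aval a s < 2 ^ (growth a + 2 + z)"
    using aval_le_growth[OF assms, of a] by linarith
qed simp

lemma acost_le:
  assumes "store_bounded z s"
  shows "acost a s \<le> poly (aexp_poly a) z"
proof (induction a)
  case (Const k)
  then show ?case using bin_length_aval[OF assms, of "Const k"] by simp
next
  case (Read x a)
  then show ?case using bin_length_aval[OF assms, of "Read x a"] by simp
next
  case (Add a b)
  then show ?case using bin_length_aval[OF assms, of "Add a b"] by simp
next
  case (Sub a b)
  then show ?case using bin_length_aval[OF assms, of "Sub a b"] by simp
qed

lemma bcost_le:
  assumes "store_bounded z s"
  shows "bcost b s \<le> poly (bexp_poly b) z"
  by (induction b) (auto intro: add_mono acost_le[OF assms])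

lemma aval_sum_free:
  assumes "store_bounded z s"
  shows "sum_free e \<Longrightarrow> aval e s \<le> 2 ^ Suc z"
proof (induction e)
  case (Const k)
  have "(1::nat) \<le> 2 ^ Suc z" by (rule one_le_power) simp
  with Const show ?case by (metis aval.simps(1) order_trans sum_free.simps(1))
qed (use store_boundedD[OF assms] in \<open>auto simp: le_diff_conv trans_le_add1\<close>)

text \<open>Boundedness and time go through one induction, as the bound on the store prices each
  operation and must survive to the next one. It survives because stored expressions are free of
  sums and the only incremented cells are loop counters; \<open>inlen\<close> is never overwritten,
  so each loop makes at most 2 * z rounds.\<close>

theorem run_exec:
  assumes "well_formed p" "store_bounded z s" "s ''inlen'' 0 \<le> z"
  shows "store_bounded z (run p s) \<and> (\<exists>t. exec (compile p) s t (run p s) \<and> t \<le> poly (time_poly p) z)"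
  using assms
proof (induction p arbitrary: s)
  case Nop
  then show ?case by (auto intro!: exI[of _ 1] exec.intros)
next
  case (Asg x a e)
  have "store_bounded z (run (Asg x a e) s)"
    using Asg aval_sum_free[of z s e] by (simp add: store_bounded_def)
  moreover have "acost a s + acost e s + 1 \<le> poly (time_poly (Asg x a e)) z"
    using acost_le[OF Asg(2), of a] acost_le[OF Asg(2), of e] by simp
  ultimately show ?case
    using exec.Write[of x a e s] by (metis compile.simps(2) run.simps(2))
next
  case (Then p q)
  have "''inlen'' \<notin> written p"
    using Then.prems(1)
    by (induction p) auto
  then have "run p s ''inlen'' = s ''inlen''"
    by (rule run_frame)
  with Then have p: "store_bounded z (run p s)" "\<exists>t. exec (compile p) s t (run p s) \<and> t \<le> poly (time_poly p) z"
    and q: "store_bounded z (run q (run p s))"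
      "\<exists>t. exec (compile q) (run p s) t (run q (run p s)) \<and> t \<le> poly (time_poly q) z"
    by auto
  then obtain t t' where "exec (compile p) s t (run p s)" "t \<le> poly (time_poly p) z"
    "exec (compile q) (run p s) t' (run q (run p s))" "t' \<le> poly (time_poly q) z"
    by blast
  then have "exec (compile (Then p q)) s (t + t') (run (Then p q) s)" "t + t' \<le> poly (time_poly (Then p q)) z"
    by (auto intro: exec.intros)
  with q(1) show ?case by auto
next
  case (Cond b p q)
  note b = bcost_le[OF Cond.prems(2), of b]
  show ?case
  proof (cases "bval b s")
    case True
    with Cond obtain t where "store_bounded z (run p s)" "exec (compile p) s t (run p s)"
      "t \<le> poly (time_poly p) z" by auto
    with True b show ?thesis
      by (auto intro!: exI[of _ "bcost b s + t"] exec.IfTrue)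
  next
    case False
    with Cond obtain t where "store_bounded z (run q s)" "exec (compile q) s t (run q s)"
      "t \<le> poly (time_poly q) z" by auto
    with False b show ?thesis
      by (auto intro!: exI[of _ "bcost b s + t"] exec.IfFalse)
  qed
next
  case (For x p)
  define f where "f = (\<lambda>i s. set_cell x (Suc i) (run p s))"
  define l where "l = s ''inlen'' 0"
  define guard where "guard = Less (cell x) loop_bound"
  define incr where "incr = Write x (Const 0) (Add (cell x) (Const 1))"
  define body where "body = Seq (compile p) incr"
  define T where "T = poly (bexp_poly guard) z + poly (time_poly p) z
      + poly (write_poly (Const 0) (Add (cell x) (Const 1))) z"
  from For.prems have wf: "well_formed p" "x \<notin> written p" "x \<noteq> ''inlen''" and l: "l \<le> z"
    by (auto simp: l_def)
  have inlen: "''inlen'' \<notin> written p"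
    using wf(1) by (induction p) auto
  have z2: "2 * z \<le> 2 ^ Suc z"
    using less_exp[of z] by simp
  have loop: "store_bounded z (fold f [i..<2 * l] s) \<and>
      (\<exists>t. exec (While guard body) s t (fold f [i..<2 * l] s)
        \<and> t \<le> poly (bexp_poly guard) z + (2 * l - i) * T)"
    if "i \<le> 2 * l" "s x 0 = i" "store_bounded z s" "s ''inlen'' 0 = l" for i s
    using that
  proof (induction "2 * l - i" arbitrary: i s)
    case 0
    then have "\<not> bval guard s" "[i..<2 * l] = []"
      by (auto simp: guard_def)
    with 0 bcost_le[of z s guard] show ?case
      by (auto intro!: exI[of _ "bcost guard s"] exec.WhileFalse)
  next
    case (Suc k)
    then have i: "i < 2 * l" by simp
    with Suc.prems have "bval guard s" by (simp add: guard_def)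
    obtain t where p: "store_bounded z (run p s)" "exec (compile p) s t (run p s)"
      "t \<le> poly (time_poly p) z"
      using For.IH[OF wf(1) Suc.prems(3)] Suc.prems(4) l by auto
    have px: "run p s x = s x" and pl: "run p s ''inlen'' = s ''inlen''"
      using run_frame[OF wf(2)] run_frame[OF inlen] by auto
    have f: "f i s = (run p s)(x := (run p s x)(aval (Const 0) (run p s) :=
        aval (Add (cell x) (Const 1)) (run p s)))"
      using Suc.prems px by (simp add: f_def set_cell_def)
    define t' where "t' = acost (Const 0) (run p s) + acost (Add (cell x) (Const 1)) (run p s) + 1"
    have "exec incr (run p s) t' (f i s)"
      unfolding f incr_def t'_def by (rule exec.Write)
    then have body: "exec body s (t + t') (f i s)"
      unfolding body_def using p(2) by (rule exec.Seq[rotated])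
    have t': "t' \<le> poly (write_poly (Const 0) (Add (cell x) (Const 1))) z"
      unfolding t'_def
      using acost_le[OF p(1), of "Const 0"] acost_le[OF p(1), of "Add (cell x) (Const 1)"] by simp
    have "Suc i \<le> 2 ^ Suc z"
      using i l z2 by linarith
    then have bd: "store_bounded z (f i s)"
      using p(1) by (simp add: f_def set_cell_def store_bounded_def)
    have fi: "(f i s) x 0 = Suc i" "(f i s) ''inlen'' 0 = l"
      using wf(3) pl Suc.prems by (auto simp: f_def set_cell_def)
    have k: "k = 2 * l - Suc i" using Suc.hyps(2) by simp
    obtain t'' where t'': "store_bounded z (fold f [Suc i..<2 * l] (f i s))"
      "exec (While guard body) (f i s) t'' (fold f [Suc i..<2 * l] (f i s))"
      "t'' \<le> poly (bexp_poly guard) z + (2 * l - Suc i) * T"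
      using Suc.hyps(1)[OF k _ fi(1) bd fi(2)] i by auto
    have fold: "fold f [Suc i..<2 * l] (f i s) = fold f [i..<2 * l] s"
      using i by (simp add: upt_conv_Cons)
    have "bcost guard s + (t + t') \<le> T"
      using bcost_le[OF Suc.prems(3), of guard] p(3) t' by (simp add: T_def)
    moreover have "(2 * l - i) * T = T + (2 * l - Suc i) * T"
      using i by (metis Suc_diff_Suc mult_Suc)
    ultimately have "bcost guard s + (t + t') + t'' \<le> poly (bexp_poly guard) z + (2 * l - i) * T"
      using t''(3) by linarith
    moreover have "exec (While guard body) s (bcost guard s + (t + t') + t'') (fold f [i..<2 * l] s)"
      using exec.WhileTrue[OF \<open>bval guard s\<close> body t''(2)] fold by simp
    ultimately show ?case
      using t''(1) fold by auto
  qed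
  have "store_bounded z (set_cell x 0 s)" "set_cell x 0 s ''inlen'' 0 = l"
    using For.prems wf(3) by (auto simp: store_bounded_def set_cell_def l_def)
  then obtain t where t: "store_bounded z (fold f [0..<2 * l] (set_cell x 0 s))"
    "exec (While guard body) (set_cell x 0 s) t (fold f [0..<2 * l] (set_cell x 0 s))"
    "t \<le> poly (bexp_poly guard) z + 2 * l * T"
    using loop[of 0 "set_cell x 0 s"] by (auto simp: set_cell_def)
  define t0 where "t0 = acost (Const 0) s + acost (Const 0) s + 1"
  have "exec (Write x (Const 0) (Const 0)) s t0 (set_cell x 0 s)"
    using exec.Write[of x "Const 0" "Const 0" s] by (simp add: set_cell_def t0_def)
  then have "exec (compile (For x p)) s (t0 + t) (run (For x p) s)"
    using t(2) by (auto simp: f_def l_def guard_def body_def incr_def intro: exec.Seq)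
  moreover have "t0 + t \<le> poly (time_poly (For x p)) z"
  proof -
    have "t0 \<le> poly (write_poly (Const 0) (Const 0)) z"
      unfolding t0_def using acost_le[OF For.prems(2), of "Const 0"] by simp
    moreover have "2 * l * T \<le> 2 * z * T"
      using l by simp
    moreover have "poly (time_poly (For x p)) z =
        poly (write_poly (Const 0) (Const 0)) z + poly (bexp_poly guard) z + 2 * z * T"
      by (simp add: T_def guard_def)
    ultimately show ?thesis
      using t(3) by linarith
  qed
  moreover have "run (For x p) s = fold f [0..<2 * l] (set_cell x 0 s)"
    by (simp add: f_def l_def)
  ultimately show ?case
    using t(1) by metis
qed

text \<open>The loop length and the value of the counter are tracked here once, so that the
  invariants \<open>I\<close> need to mention neither.\<close>

lemma run_For:
  assumes "s ''inlen'' 0 = l" "x \<noteq> ''inlen''" "''inlen'' \<notin> written p" "x \<notin> written p"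
    and "I 0 (set_cell x 0 s)"
    and "\<And>i s. i < 2 * l \<Longrightarrow> s ''inlen'' 0 = l \<Longrightarrow> s x 0 = i \<Longrightarrow> I i s \<Longrightarrow>
      I (Suc i) (set_cell x (Suc i) (run p s))"
  shows "I (2 * l) (run (For x p) s)"
proof -
  define f where "f = (\<lambda>i s. set_cell x (Suc i) (run p s))"
  have "I j (fold f [0..<j] (set_cell x 0 s)) \<and> fold f [0..<j] (set_cell x 0 s) ''inlen'' 0 = l \<and>
      fold f [0..<j] (set_cell x 0 s) x 0 = j"
    if "j \<le> 2 * l" for j
    using that
  proof (induction j)
    case 0
    have "set_cell x 0 s ''inlen'' 0 = l" "set_cell x 0 s x 0 = 0"
      using assms(1,2) by (auto simp: set_cell_def)
    then show ?case using assms(5) by simp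
  next
    case (Suc j)
    let ?s = "fold f [0..<j] (set_cell x 0 s)"
    have "I (Suc j) (f j ?s)"
      using Suc assms(6)[of j ?s] by (simp add: f_def[THEN fun_cong, THEN fun_cong, of j ?s])
    moreover have "f i t ''inlen'' = t ''inlen''" "f i t x 0 = Suc i" for i t
      using assms(2) run_frame[OF assms(3)] by (auto simp: f_def set_cell_def)
    ultimately show ?case using Suc by simp
  qed
  from this[of "2 * l"] show ?thesis using assms(1) by (simp add: f_def)
qed

section \<open>Vertex-weighted bipartite matchings\<close>

definition bipartition :: "('a \<Rightarrow> 'a \<Rightarrow> bool) \<Rightarrow> 'a set \<Rightarrow> 'a set \<Rightarrow> bool" where
  "bipartition A X Y \<longleftrightarrow> X \<inter> Y = {} \<and> symp A \<and>
     (\<forall>a b. A a b \<longrightarrow> a \<in> X \<and> b \<in> Y \<or> a \<in> Y \<and> b \<in> X)"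

text \<open>A matching is given by the involution that exchanges matched vertices and fixes the others.\<close>

definition matching_on :: "('a \<Rightarrow> 'a \<Rightarrow> bool) \<Rightarrow> 'a set \<Rightarrow> ('a \<Rightarrow> 'a) \<Rightarrow> bool" where
  "matching_on A V mate \<longleftrightarrow>
     (\<forall>v\<in>V. mate v \<in> V \<and> mate (mate v) = v \<and> (mate v \<noteq> v \<longrightarrow> A v (mate v)))"

abbreviation covered :: "'a set \<Rightarrow> ('a \<Rightarrow> 'a) \<Rightarrow> 'a set" where
  "covered V mate \<equiv> {v \<in> V. mate v \<noteq> v}"

text \<open>A walk leaves \<open>s\<close> by any edge and returns by matching edges; only the
  vertices entered by the outgoing edges are collected. In a bipartite graph such walks are as good
  as simple paths, since no blossoms arise.\<close>

inductive_set alt_reach :: "('a \<Rightarrow> 'a \<Rightarrow> bool) \<Rightarrow> ('a \<Rightarrow> 'a) \<Rightarrow> 'a \<Rightarrow> 'a set"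
  for A mate s where
  base: "A s b \<Longrightarrow> b \<in> alt_reach A mate s"
| step: "a \<in> alt_reach A mate s \<Longrightarrow> mate a \<noteq> a \<Longrightarrow> A (mate a) b \<Longrightarrow> b \<in> alt_reach A mate s"

text \<open>Complementary slackness for the Lagrangian (weight of the covered vertices) minus
  \<open>l\<close> times (number of edges), with the dual variables written as one potential that is monotone
  along the residual graph.\<close>

definition certificate ::
    "('a \<Rightarrow> 'a \<Rightarrow> bool) \<Rightarrow> 'a set \<Rightarrow> 'a set \<Rightarrow> ('a \<Rightarrow> 'a) \<Rightarrow> ('a \<Rightarrow> nat) \<Rightarrow> int \<Rightarrow> ('a \<Rightarrow> int) \<Rightarrow> bool" where
  "certificate A X Y mate w l h \<longleftrightarrow>
     (\<forall>x\<in>X. \<forall>y\<in>Y. A x y \<longrightarrow> h x \<le> h y) \<and>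
     (\<forall>v\<in>X \<union> Y. h (mate v) = h v) \<and>
     (\<forall>x\<in>X. if mate x = x then l - int (w x) \<le> h x else h x \<le> l - int (w x)) \<and>
     (\<forall>y\<in>Y. if mate y = y then h y \<le> int (w y) else int (w y) \<le> h y)"

section \<open>Duality for augmenting paths and the multiplier\<close>

lemma bipartition_swap: "bipartition A X Y \<Longrightarrow> bipartition A Y X"
  by (auto simp: bipartition_def)

text \<open>Exchanging the sides reverses the residual graph, so the potential is reflected. Since a
  path may start at a free vertex of either side, this reduces both cases to starts in
  \<open>X\<close>.\<close>

lemma certificate_swap:
  assumes "bipartition A X Y" "certificate A X Y mate w l h"
  shows "certificate A Y X mate w l (\<lambda>v. l - h v)"
  using assms unfolding certificate_def bipartition_def
  by (auto simp: symp_def split: if_splits)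

lemma mate_other_side:
  assumes "bipartition A X Y" "matching_on A (X \<union> Y) mate" "mate v \<noteq> v"
  shows "v \<in> Y \<Longrightarrow> mate v \<in> X" "v \<in> X \<Longrightarrow> mate v \<in> Y"
  using assms unfolding bipartition_def matching_on_def by (metis UnI1 UnI2 disjoint_iff)+

text \<open>Along an alternating walk the potential is constant on matching edges and cannot drop on
  an edge taken from \<open>X\<close> to \<open>Y\<close>.\<close>

lemma alt_reach_potential:
  assumes bip: "bipartition A X Y" and M: "matching_on A (X \<union> Y) mate"
    and cert: "certificate A X Y mate w l h" and s: "s \<in> X"
    and "b \<in> alt_reach A mate s"
  shows "b \<in> Y \<and> h s \<le> h b"
  using assms(5)
proof induction
  case (base b)
  then have "b \<in> Y" using bip s by (auto simp: bipartition_def)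
  then show ?case using cert base s by (auto simp: certificate_def)
next
  case (step a b)
  then have "mate a \<in> X" using mate_other_side[OF bip M] by blast
  moreover from this have "b \<in> Y"
    using bip step(3) unfolding bipartition_def by blast
  ultimately have "h (mate a) \<le> h b"
    using cert step(3) by (auto simp: certificate_def)
  then show ?case using cert step.IH \<open>b \<in> Y\<close> by (auto simp: certificate_def)
qed

text \<open>Weak duality: the potential is at least \<open>l - w s\<close> at the free start, at
  most \<open>w b\<close> at the free end, and does not decrease in between.\<close>

lemma augmenting_cost_ge:
  assumes bip: "bipartition A X Y" and M: "matching_on A (X \<union> Y) mate"
    and cert: "certificate A X Y mate w l h" and s: "s \<in> X" "mate s = s"
    and b: "b \<in> alt_reach A mate s" "mate b = b"
  shows "l \<le> int (w s + w b)"
proof -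
  have "b \<in> Y" "h s \<le> h b"
    using alt_reach_potential[OF bip M cert s(1) b(1)] by auto
  moreover have "l - int (w s) \<le> h s" "h b \<le> int (w b)"
    using cert s b \<open>b \<in> Y\<close> by (auto simp: certificate_def)
  ultimately show ?thesis by simp
qed

text \<open>Raising \<open>l\<close> to \<open>l'\<close> violates only the lower bounds at free
  vertices of \<open>X\<close>. The repair \<open>h'\<close> is the least potential above
  \<open>h\<close> that meets the new bounds and is monotone along the residual graph: the bound
  \<open>l' - w s\<close> of each free \<open>s\<close> is propagated to all vertices reachable from
  \<open>s\<close>, which form the relation \<open>S\<close>.\<close>

lemma certificate_raise:
  assumes bip: "bipartition A X Y" and M: "matching_on A (X \<union> Y) mate"
    and fin: "finite X" and cert: "certificate A X Y mate w l h" and "l \<le> l'"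
    and cost: "\<And>s b. s \<in> X \<Longrightarrow> mate s = s \<Longrightarrow> b \<in> alt_reach A mate s \<Longrightarrow> mate b = b \<Longrightarrow>
      l' \<le> int (w s + w b)"
  shows "\<exists>h. certificate A X Y mate w l' h"
proof -
  define S where "S v = {s \<in> X. mate s = s \<and>
    (v = s \<or> v \<in> alt_reach A mate s \<or> mate v \<noteq> v \<and> mate v \<in> alt_reach A mate s)}" for v
  define h' where "h' v = Max (insert (h v) ((\<lambda>s. l' - int (w s)) ` S v))" for v
  have fS: "finite (S v)" for v
    using fin by (simp add: S_def)
  have h'_le: "h' v \<le> k \<longleftrightarrow> h v \<le> k \<and> (\<forall>s\<in>S v. l' - int (w s) \<le> k)" for v k
    unfolding h'_def by (subst Max_le_iff) (auto simp: fS)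
  have le_h': "h v \<le> h' v" "s \<in> S v \<Longrightarrow> l' - int (w s) \<le> h' v" for v s
    unfolding h'_def by (rule Max_ge; use fS in auto)+
  have mono: "h' a \<le> h' b" if "S a \<subseteq> S b" "h a \<le> h b" for a b
    unfolding h'_le using that le_h'[where v = b] by (meson order_trans subsetD)
  have S_mate_sub: "S v \<subseteq> S (mate v)" if "v \<in> X \<union> Y" for v
  proof (cases "mate v = v")
    case False
    have "mate (mate v) = v" using M that by (auto simp: matching_on_def)
    with False show ?thesis by (auto simp: S_def)
  qed simp
  have "h' (mate v) = h' v" if v: "v \<in> X \<union> Y" for v
  proof -
    have "mate (mate v) = v" "mate v \<in> X \<union> Y" using M v by (auto simp: matching_on_def)
    then have "S (mate v) = S v"
      using S_mate_sub[OF v] S_mate_sub[of "mate v"] by auto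
    moreover have "h (mate v) = h v" using cert v by (auto simp: certificate_def)
    ultimately show ?thesis by (simp add: h'_def)
  qed
  moreover have "h' x \<le> h' y" if xy: "x \<in> X" "y \<in> Y" "A x y" for x y
  proof (rule mono)
    show "h x \<le> h y" using cert xy by (auto simp: certificate_def)
    show "S x \<subseteq> S y"
    proof
      fix s assume s: "s \<in> S x"
      then have "s \<in> X" by (simp add: S_def)
      have "x \<notin> alt_reach A mate s"
        using alt_reach_potential[OF bip M cert \<open>s \<in> X\<close>] xy bip
        by (auto simp: bipartition_def)
      then consider "x = s" | "mate x \<noteq> x" "mate x \<in> alt_reach A mate s"
        using s by (auto simp: S_def)
      then have "y \<in> alt_reach A mate s"
      proof cases
        case 1
        then show ?thesis using xy by (auto intro: alt_reach.base)
      next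
        case 2
        moreover have "mate (mate x) = x" using M xy by (auto simp: matching_on_def)
        ultimately show ?thesis using xy alt_reach.step[of "mate x"] by auto
      qed
      then show "s \<in> S y" using s by (simp add: S_def)
    qed
  qed
  moreover have "if mate x = x then l' - int (w x) \<le> h' x else h' x \<le> l' - int (w x)"
    if x: "x \<in> X" for x
  proof (cases "mate x = x")
    case True
    then have "x \<in> S x" using x by (simp add: S_def)
    then show ?thesis using le_h' True by auto
  next
    case False
    have hx: "h x \<le> l - int (w x)" using cert x False by (auto simp: certificate_def)
    \<comment> \<open>The chain \<open>l - w s\<close> \<le> \<open>h s\<close> \<le>
      \<open>h x\<close> \<le> \<open>l - w x\<close> yields \<open>w x\<close> \<le>
      \<open>w s\<close>, a comparison of weights that holds for every multiplier.\<close>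
    have "l' - int (w s) \<le> l' - int (w x)" if s: "s \<in> S x" for s
    proof -
      have sX: "s \<in> X" "mate s = s" using s by (auto simp: S_def)
      have "h (mate x) = h x" using cert x by (auto simp: certificate_def)
      then have "h s \<le> h x"
        using s alt_reach_potential[OF bip M cert sX(1)]
        by (force simp: S_def)
      moreover have "l - int (w s) \<le> h s" using cert sX by (auto simp: certificate_def)
      ultimately show ?thesis using hx by simp
    qed
    then show ?thesis using False hx \<open>l \<le> l'\<close> by (auto simp: h'_le)
  qed
  moreover have "if mate y = y then h' y \<le> int (w y) else int (w y) \<le> h' y" if y: "y \<in> Y" for y
  proof (cases "mate y = y")
    case True
    \<comment> \<open>Only at free ends in \<open>Y\<close> can the raised potential become too
      large; this is what limits \<open>l'\<close> to the cost of a cheapest augmenting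
      path.\<close>
    have "l' - int (w s) \<le> int (w y)" if s: "s \<in> S y" for s
    proof -
      have "s \<in> X" "mate s = s" "y \<in> alt_reach A mate s"
        using s True y bip by (auto simp: S_def bipartition_def)
      then show ?thesis using cost[of s y] True by simp
    qed
    then show ?thesis using True y cert by (auto simp: h'_le certificate_def)
  next
    case False
    then have "int (w y) \<le> h y" using y cert by (auto simp: certificate_def)
    then show ?thesis using False le_h'(1)[of y] by simp
  qed
  ultimately have "certificate A X Y mate w l' h'"
    unfolding certificate_def by blast
  then show ?thesis by blast
qed

text \<open>State of the search for augmenting paths from \<open>s\<close>: a vertex \<open>b\<close> is discovered when
  \<open>par b \<noteq> b\<close>, and the ranks record the order of discovery.\<close>

definition outer :: "('a \<Rightarrow> 'a) \<Rightarrow> 'a \<Rightarrow> ('a \<Rightarrow> 'a) \<Rightarrow> 'a \<Rightarrow> bool" where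
  "outer mate s par a \<longleftrightarrow> a = s \<or> mate a \<noteq> a \<and> par (mate a) \<noteq> mate a"

definition search_tree ::
    "('a \<Rightarrow> 'a \<Rightarrow> bool) \<Rightarrow> 'a set \<Rightarrow> ('a \<Rightarrow> 'a) \<Rightarrow> 'a \<Rightarrow> ('a \<Rightarrow> 'a) \<Rightarrow> ('a \<Rightarrow> nat) \<Rightarrow> bool" where
  "search_tree A V mate s par rk \<longleftrightarrow>
     (\<forall>b\<in>V. par b \<noteq> b \<longrightarrow> A (par b) b \<and> rk b < card (covered V par) \<and>
        (par b = s \<or> mate (par b) \<noteq> par b \<and> par (mate (par b)) \<noteq> mate (par b) \<and>
           rk (mate (par b)) < rk b))"

text \<open>\<open>covered V par\<close> is the set of discovered vertices. Its size before the
  discovery exceeds all earlier ranks and serves as the new one, so ranks also stay below the number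
  of vertices.\<close>

lemma search_tree_extend:
  assumes "search_tree A V mate s par rk" "finite V" "b \<in> V" "par b = b" "A a b" "a \<noteq> b"
    and "outer mate s par a" "mate a \<in> V"
  shows "search_tree A V mate s (par(b := a)) (rk(b := card (covered V par)))"
    and "card (covered V (par(b := a))) = Suc (card (covered V par))"
proof -
  have "covered V (par(b := a)) = insert b (covered V par)"
    using assms by auto
  then show card: "card (covered V (par(b := a))) = Suc (card (covered V par))"
    using assms by simp
  show "search_tree A V mate s (par(b := a)) (rk(b := card (covered V par)))"
    using assms unfolding search_tree_def card outer_def
    by (smt (verit) fun_upd_apply less_Suc_eq)
qed

lemma search_tree_sound:
  assumes tree: "search_tree A V mate s par rk" and M: "matching_on A V mate"
    and "\<And>a b. A a b \<Longrightarrow> a \<in> V"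
  shows "b \<in> V \<Longrightarrow> par b \<noteq> b \<Longrightarrow> b \<in> alt_reach A mate s"
proof (induction "rk b" arbitrary: b rule: less_induct)
  case less
  have b: "A (par b) b" using tree less by (auto simp: search_tree_def)
  show ?case
  proof (cases "par b = s")
    case True
    then show ?thesis using b by (auto intro: alt_reach.base)
  next
    case False
    let ?c = "mate (par b)"
    have "par b \<in> V" using assms(3) b .
    then have c: "?c \<in> V" "mate ?c = par b" using M by (auto simp: matching_on_def)
    have "par ?c \<noteq> ?c" "rk ?c < rk b" "?c \<noteq> par b"
      using tree less False by (auto simp: search_tree_def)
    then have "?c \<in> alt_reach A mate s" using less c by blast
    then show ?thesis using alt_reach.step[of ?c] c b \<open>?c \<noteq> par b\<close> by auto
  qed
qed

lemma search_tree_complete: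
  assumes closed: "\<And>a b. A a b \<Longrightarrow> outer mate s par a \<Longrightarrow> par b \<noteq> b"
    and M: "matching_on A V mate" and V: "\<And>a b. A a b \<Longrightarrow> b \<in> V"
    and "b \<in> alt_reach A mate s"
  shows "par b \<noteq> b \<and> b \<in> V"
  using assms(4)
proof induction
  case (base b)
  then show ?case using closed V by (auto simp: outer_def)
next
  case (step a b)
  then have "mate (mate a) = a" using M by (auto simp: matching_on_def)
  then show ?case using closed[OF step(3)] step V by (auto simp: outer_def)
qed

text \<open>Augmentation proceeds from the end \<open>e\<close> of the path towards its start \<open>s\<close>. Before each step
  the current vertex \<open>cur\<close> is free; it takes over the partner \<open>par cur\<close>, whose previous mate
  becomes the current vertex.\<close>

definition augmentation_state ::
    "('a \<Rightarrow> 'a \<Rightarrow> bool) \<Rightarrow> 'a set \<Rightarrow> 'a set \<Rightarrow> 'a \<Rightarrow> 'a \<Rightarrow> ('a \<Rightarrow> 'a) \<Rightarrow> ('a \<Rightarrow> nat) \<Rightarrow> ('a \<Rightarrow> int) \<Rightarrow>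
      int \<Rightarrow> ('a \<Rightarrow> 'a) \<Rightarrow> 'a \<Rightarrow> bool" where
  "augmentation_state A V C s e par rk h k mate cur \<longleftrightarrow>
     matching_on A V mate \<and> (\<forall>v\<in>V. h (mate v) = h v) \<and>
     (if cur = s then covered V mate = insert s (insert e C)
      else cur \<in> insert e C \<and> cur \<in> V \<and> par cur \<noteq> cur \<and> mate cur = cur \<and> mate s = s \<and> h cur = k \<and>
        covered V mate = insert e C - {cur} \<and>
        (\<forall>b\<in>V. par b \<noteq> b \<longrightarrow> rk b \<le> rk cur \<longrightarrow>
           par b = s \<or> mate (par b) \<noteq> par b \<and> par (mate (par b)) \<noteq> mate (par b) \<and>
             rk (mate (par b)) < rk b))"

section \<open>Flipping the matching along a path of the search tree\<close>

lemma matching_on_insert: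
  assumes M: "matching_on A V mate" and "symp A" and ab: "a \<in> V" "b \<in> V" "mate a = a" "mate b = b" "A a b"
  shows "matching_on A V (mate(a := b, b := a))"
proof -
  let ?m = "mate(a := b, b := a)"
  have "A b a" using ab \<open>symp A\<close> by (auto dest: sympD)
  have "?m v \<in> V \<and> ?m (?m v) = v \<and> (?m v \<noteq> v \<longrightarrow> A v (?m v))" if v: "v \<in> V" for v
  proof (cases "v = a \<or> v = b")
    case True
    then show ?thesis using ab \<open>A b a\<close> by auto
  next
    case False
    have "mate v \<in> V \<and> mate (mate v) = v \<and> (mate v \<noteq> v \<longrightarrow> A v (mate v))"
      using M v by (simp add: matching_on_def)
    moreover from this have "mate v \<noteq> a \<and> mate v \<noteq> b"
      using ab False by metis
    ultimately show ?thesis using False by simp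
  qed
  then show ?thesis by (simp add: matching_on_def)
qed

lemma matching_on_remove:
  assumes M: "matching_on A V mate" and a: "a \<in> V"
  shows "matching_on A V (mate(a := a, mate a := mate a))"
proof -
  let ?m = "mate(a := a, mate a := mate a)"
  have a': "mate (mate a) = a" using M a by (simp add: matching_on_def)
  have "?m v \<in> V \<and> ?m (?m v) = v \<and> (?m v \<noteq> v \<longrightarrow> A v (?m v))" if v: "v \<in> V" for v
  proof (cases "v = a \<or> v = mate a")
    case True
    then show ?thesis using v by auto
  next
    case False
    have "mate v \<in> V \<and> mate (mate v) = v \<and> (mate v \<noteq> v \<longrightarrow> A v (mate v))"
      using M v by (simp add: matching_on_def)
    moreover from this have "mate v \<noteq> a \<and> mate v \<noteq> mate a"
      using a' False by metis
    ultimately show ?thesis using False by simp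
  qed
  then show ?thesis by (simp add: matching_on_def)
qed

text \<open>On a cheapest path the potential is constant: \<open>k\<close> \<le>
  \<open>h (par cur)\<close> \<le> \<open>h cur\<close> = \<open>k\<close>. Hence both the edge
  given up and the edge gained join vertices of equal potential, and \<open>h\<close> stays constant
  on matching edges. The pointers still to be followed start at vertices of rank at most
  \<open>rk nxt\<close>, and their part of the matching has not been touched.\<close>

lemma augmentation_step:
  assumes st: "augmentation_state A V C s e par rk h k mate cur" and "cur \<noteq> s"
    and sV: "s \<in> V" "s \<notin> C" "s \<noteq> e" and eV: "e \<notin> C" "e \<in> V"
    and "symp A" and AV: "\<And>a b. A a b \<Longrightarrow> a \<in> V \<and> b \<in> V \<and> a \<noteq> b"
    and par: "\<And>b. b \<in> V \<Longrightarrow> par b \<noteq> b \<Longrightarrow> A (par b) b \<and> k \<le> h (par b) \<and> h (par b) \<le> h b \<and> par (par b) = par b"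
  defines "nxt \<equiv> mate (par cur)"
  defines "mate' \<equiv> mate(nxt := nxt, par cur := cur, cur := par cur)"
  shows "augmentation_state A V C s e par rk h k mate' nxt"
    and "nxt \<noteq> s \<Longrightarrow> rk nxt < rk cur"
proof -
  let ?x = "par cur"
  have M: "\<And>v. v \<in> V \<Longrightarrow> mate v \<in> V \<and> mate (mate v) = v \<and> (mate v \<noteq> v \<longrightarrow> A v (mate v))"
    and hM: "\<And>v. v \<in> V \<Longrightarrow> h (mate v) = h v"
    and cur: "cur \<in> insert e C" "cur \<in> V" "?x \<noteq> cur" "mate cur = cur" "mate s = s" "h cur = k"
    and cov: "covered V mate = insert e C - {cur}"
    and chain: "\<And>b. b \<in> V \<Longrightarrow> par b \<noteq> b \<Longrightarrow> rk b \<le> rk cur \<Longrightarrow>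
           par b = s \<or> mate (par b) \<noteq> par b \<and> par (mate (par b)) \<noteq> mate (par b) \<and>
             rk (mate (par b)) < rk b"
    using st \<open>cur \<noteq> s\<close> unfolding augmentation_state_def matching_on_def by simp_all
  have x: "A ?x cur" "?x \<in> V" "h ?x = k" using par[OF cur(2,3)] cur AV by auto
  have "A cur ?x" using x \<open>symp A\<close> by (auto dest: sympD)
  have nV: "nxt \<in> V" "mate nxt = ?x" "h nxt = k" using M[of ?x] hM[of ?x] x by (auto simp: nxt_def)
  \<comment> \<open>The update is split into the removal of the edge at \<open>?x\<close> and the
    insertion of the edge to \<open>cur\<close>. If \<open>?x\<close> is the free start, the removal
    changes nothing.\<close>
  have "mate' = (mate(?x := ?x, nxt := nxt))(?x := cur, cur := ?x)"
    using cur(3) by (auto simp: mate'_def fun_eq_iff)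
  moreover have "cur \<noteq> nxt \<or> ?x = nxt"
    using cur(4) nV(2) by auto
  then have "(mate(?x := ?x, nxt := nxt)) ?x = ?x" "(mate(?x := ?x, nxt := nxt)) cur = cur"
    using cur(3,4) by (auto simp: fun_upd_apply)
  moreover have "matching_on A V (mate(?x := ?x, nxt := nxt))"
    using matching_on_remove[of A V mate ?x] st x(2) by (simp add: augmentation_state_def nxt_def)
  ultimately have M': "matching_on A V mate'"
    using matching_on_insert[OF _ \<open>symp A\<close> x(2) cur(2) _ _ x(1)] by metis
  have h': "\<forall>v\<in>V. h (mate' v) = h v"
    using hM x(3) cur(6) by (simp add: mate'_def)
  have "augmentation_state A V C s e par rk h k mate' nxt \<and> (nxt \<noteq> s \<longrightarrow> rk nxt < rk cur)"
  proof (cases "?x = s")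
    case True
    \<comment> \<open>The start is free, hence its own mate, and the walk back ends here.\<close>
    then have n: "nxt = s" using cur by (simp add: nxt_def)
    have m': "mate' = mate(s := cur, cur := s)"
      using True n \<open>cur \<noteq> s\<close> by (auto simp: mate'_def fun_eq_iff)
    have "covered V mate' = insert s (insert cur (covered V mate))"
      using \<open>cur \<noteq> s\<close> cur sV by (auto simp: m')
    then have "covered V mate' = insert s (insert e C)"
      using cov cur(1) by auto
    then show ?thesis using n M' h' by (simp add: augmentation_state_def)
  next
    case False
    then have old: "mate ?x \<noteq> ?x" "par nxt \<noteq> nxt" "rk nxt < rk cur"
      using chain[OF cur(2,3)] by (auto simp: nxt_def)
    have ne: "nxt \<noteq> ?x" "nxt \<noteq> cur" "nxt \<noteq> s"
      using old nV cur False \<open>cur \<noteq> s\<close> by (auto simp: nxt_def)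
    have "v \<in> covered V mate' \<longleftrightarrow> v \<in> insert cur (covered V mate) - {nxt}" for v
    proof -
      consider "v = ?x" | "v = cur" | "v = nxt" | "v \<noteq> ?x" "v \<noteq> cur" "v \<noteq> nxt" by blast
      then show ?thesis
        by cases (use ne(1,2) ne(1,2)[symmetric] cur(2,3) x(2) old(1) in \<open>simp_all add: mate'_def\<close>)
    qed
    then have "covered V mate' = insert cur (covered V mate) - {nxt}" by blast
    then have "covered V mate' = insert e C - {nxt}"
      using cov cur(1) by auto
    moreover have "nxt \<in> covered V mate"
      using nV(1,2) ne(1) by simp
    then have "nxt \<in> insert e C"
      unfolding cov by simp
    moreover have "mate' nxt = nxt"
      using ne(1,2) by (simp add: mate'_def)
    moreover have "mate' s = s"
      using ne(3) cur(5) False \<open>cur \<noteq> s\<close> by (simp add: mate'_def)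
    moreover have "par b = s \<or> mate' (par b) \<noteq> par b \<and> par (mate' (par b)) \<noteq> mate' (par b) \<and>
             rk (mate' (par b)) < rk b" if b: "b \<in> V" "par b \<noteq> b" "rk b \<le> rk nxt" for b
    proof (cases "par b = s")
      case False
      then have c: "mate (par b) \<noteq> par b" "par (mate (par b)) \<noteq> mate (par b)" "rk (mate (par b)) < rk b"
        using chain[OF b(1,2)] b(3) old(3) by (meson le_less_trans less_imp_le)+
      have "par b \<noteq> cur" using c(1) cur(4) by metis
      \<comment> \<open>Otherwise \<open>nxt\<close> would be the mate of \<open>par b\<close> and
        have smaller rank than \<open>b\<close>, against \<open>rk b\<close> \<le>
        \<open>rk nxt\<close>.\<close>
      moreover have "par b \<noteq> ?x" using c(3) b(3) unfolding nxt_def by (metis leD)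
      \<comment> \<open>A parent is never itself discovered, whereas \<open>nxt\<close> is.\<close>
      moreover have "par b \<noteq> nxt"
        using par[OF b(1,2)] old(2) by metis
      ultimately show ?thesis using c by (simp add: mate'_def)
    qed simp
    ultimately show ?thesis unfolding augmentation_state_def using ne(3) nV(1,3) old(2,3) M' h' by simp
  qed
  then show "augmentation_state A V C s e par rk h k mate' nxt" "nxt \<noteq> s \<Longrightarrow> rk nxt < rk cur"
    by blast+
qed

section \<open>From certificates to optimal interdiction sets\<close>

lemma card_le_stability_number:
  assumes "finite W" "stable_set W F S"
  shows "card S \<le> stability_number W F"
proof -
  have "{S. stable_set W F S} \<subseteq> Pow W" by (auto simp: stable_set_def)
  then have "finite {S. stable_set W F S}" using assms(1) by (meson finite_Pow_iff finite_subset)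
  then show ?thesis unfolding stability_number_def using assms(2) by (intro Max_ge) auto
qed

lemma stability_number_attained:
  assumes "finite W" "\<And>e. e \<in> F \<Longrightarrow> e \<noteq> {}"
  obtains S where "stable_set W F S" "card S = stability_number W F"
proof -
  have "{S. stable_set W F S} \<subseteq> Pow W" by (auto simp: stable_set_def)
  then have "finite {S. stable_set W F S}" using assms(1) by (meson finite_Pow_iff finite_subset)
  moreover have "stable_set W F {}" using assms(2) by (auto simp: stable_set_def)
  ultimately have "stability_number W F \<in> card ` {S. stable_set W F S}"
    unfolding stability_number_def by (intro Max_in) auto
  then show ?thesis using that by auto
qed

text \<open>Threshold rounding: for each of the \<open>l\<close> thresholds, the chosen vertices form a stable set,
  and every vertex \<open>v\<close> is chosen by exactly \<open>x v\<close> of them.\<close>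

lemma fractional_stable_set_le:
  fixes x :: "'a \<Rightarrow> int"
  assumes "finite W" "W \<subseteq> X \<union> Y" "X \<inter> Y = {}" "0 \<le> l"
    and x: "\<And>v. v \<in> W \<Longrightarrow> 0 \<le> x v \<and> x v \<le> l"
    and E: "\<And>e. e \<in> E \<Longrightarrow> e \<subseteq> W \<Longrightarrow> \<exists>a\<in>X. \<exists>b\<in>Y. e = {a, b} \<and> x a + x b \<le> l"
  shows "(\<Sum>v\<in>W. x v) \<le> l * int (stability_number W (induced_edges E W))"
proof -
  \<comment> \<open>The two sides use opposite thresholds: an edge with both ends chosen would
    satisfy \<open>l - x b\<close> \<le> \<open>t\<close> < \<open>x a\<close>, contradicting
    \<open>x a + x b\<close> \<le> \<open>l\<close>.\<close>
  define S where "S t = {v \<in> W. if v \<in> X then t < x v else l - x v \<le> t}" for t :: int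
  have "stable_set W (induced_edges E W) (S t)" for t
  proof -
    have "\<not> e \<subseteq> S t" if e: "e \<in> E" "e \<subseteq> W" for e
    proof -
      obtain a b where ab: "a \<in> X" "b \<in> Y" "e = {a, b}" "x a + x b \<le> l" using E[OF e] by blast
      then have "b \<notin> X" using assms(3) by blast
      with ab show ?thesis by (auto simp: S_def)
    qed
    then show ?thesis by (auto simp: stable_set_def induced_edges_def S_def)
  qed
  then have card_S: "card (S t) \<le> stability_number W (induced_edges E W)" for t
    using card_le_stability_number[OF assms(1)] by blast
  have "(\<Sum>v\<in>W. x v) = (\<Sum>v\<in>W. \<Sum>t\<in>{0..<l}. if v \<in> S t then 1 else 0)"
  proof (rule sum.cong[OF refl])
    fix v assume v: "v \<in> W"
    have "{t \<in> {0..<l}. v \<in> S t} = (if v \<in> X then {0..<x v} else {l - x v..<l})"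
      using v x[OF v] by (auto simp: S_def)
    then have "int (card {t \<in> {0..<l}. v \<in> S t}) = x v"
      using x[OF v] by simp
    then show "x v = (\<Sum>t\<in>{0..<l}. if v \<in> S t then 1 else 0)"
      by (simp add: sum.If_cases Int_def)
  qed
  also have "\<dots> = (\<Sum>t\<in>{0..<l}. \<Sum>v\<in>W. if v \<in> S t then 1 else 0)"
    by (rule sum.swap)
  also have "\<dots> = (\<Sum>t\<in>{0..<l}. int (card (S t)))"
  proof (rule sum.cong[OF refl])
    fix t
    have "W \<inter> {v. v \<in> S t} = S t" by (auto simp: S_def)
    then show "(\<Sum>v\<in>W. if v \<in> S t then 1 else 0) = int (card (S t))"
      using assms(1) by (simp add: sum.If_cases)
  qed
  also have "\<dots> \<le> (\<Sum>t\<in>{0..<l}. int (stability_number W (induced_edges E W)))"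
    using card_S by (intro sum_mono) auto
  finally show ?thesis using assms(4) by simp
qed

text \<open>Interdicting a vertex \<open>v\<close> is modelled by matching \<open>v\<close> to an additional vertex \<open>v + n\<close> of
  degree one, whose weight is the cost of \<open>v\<close>.\<close>

definition pendant_adj :: "nat \<Rightarrow> nat set set \<Rightarrow> nat \<Rightarrow> nat \<Rightarrow> bool" where
  "pendant_adj n E a b \<longleftrightarrow>
     a < n \<and> b < n \<and> {a, b} \<in> E \<or> a < n \<and> b = a + n \<or> b < n \<and> a = b + n"

definition pendant_weight :: "nat \<Rightarrow> (nat \<Rightarrow> nat) \<Rightarrow> nat \<Rightarrow> nat" where
  "pendant_weight n c v = (if v < n then 0 else c (v - n))"

definition interdicted :: "nat \<Rightarrow> (nat \<Rightarrow> nat) \<Rightarrow> nat set" where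
  "interdicted n mate = {v. v < n \<and> mate v = v + n}"

lemma bipartition_pendant_adj:
  assumes "bipartite {..<n} E"
  obtains X Y where "bipartition (pendant_adj n E) X Y" "X \<union> Y = {..<2 * n}"
proof -
  obtain X Y where XY: "X \<union> Y = {..<n}" "X \<inter> Y = {}" and E: "\<forall>e\<in>E. \<exists>x\<in>X. \<exists>y\<in>Y. e = {x, y}"
    using assms by (auto simp: bipartite_def)
  let ?p = "\<lambda>v. v + n"
  have lt: "v < n" if "v \<in> X \<or> v \<in> Y" for v
    using that XY by auto
  have side: "a \<in> X \<and> b \<in> Y \<or> a \<in> Y \<and> b \<in> X" if "{a, b} \<in> E" for a b
    using E that by (metis doubleton_eq_iff)
  have "bipartition (pendant_adj n E) (X \<union> ?p ` Y) (Y \<union> ?p ` X)"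
    unfolding bipartition_def
  proof (intro conjI allI impI)
    show "(X \<union> ?p ` Y) \<inter> (Y \<union> ?p ` X) = {}" using XY lt by fastforce
    show "symp (pendant_adj n E)" by (auto simp: symp_def pendant_adj_def insert_commute)
    fix a b assume "pendant_adj n E a b"
    then show "a \<in> X \<union> ?p ` Y \<and> b \<in> Y \<union> ?p ` X \<or> a \<in> Y \<union> ?p ` X \<and> b \<in> X \<union> ?p ` Y"
      unfolding pendant_adj_def
    proof (elim disjE conjE)
      assume "{a, b} \<in> E"
      then show ?thesis using side by blast
    next
      assume "a < n" "b = a + n"
      then show ?thesis using XY by blast
    next
      assume "b < n" "a = b + n"
      then show ?thesis using XY by blast
    qed
  qed
  moreover have "(X \<union> ?p ` Y) \<union> (Y \<union> ?p ` X) = {..<2 * n}"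
  proof -
    have "(X \<union> ?p ` Y) \<union> (Y \<union> ?p ` X) = {..<n} \<union> ?p ` {..<n}"
      using XY(1) by blast
    also have "\<dots> = {..<2 * n}"
    proof -
      have "v \<in> ?p ` {..<n}" if "v < 2 * n" "\<not> v < n" for v
        using that by (intro image_eqI[of _ _ "v - n"]) auto
      then show ?thesis by auto
    qed
    finally show ?thesis .
  qed
  ultimately show ?thesis using that by blast
qed

lemma matching_pendant:
  assumes M: "matching_on (pendant_adj n E) {..<2 * n} mate" and "v < n"
  shows "mate v = v + n \<longleftrightarrow> mate (v + n) \<noteq> v + n" "mate v = v + n \<Longrightarrow> mate (v + n) = v"
    and "mate v \<noteq> v + n \<Longrightarrow> mate v < n"
proof -
  have m: "u < 2 * n \<Longrightarrow> mate (mate u) = u \<and> (mate u \<noteq> u \<longrightarrow> pendant_adj n E u (mate u))" for u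
    using M by (auto simp: matching_on_def)
  show 1: "mate v = v + n \<Longrightarrow> mate (v + n) = v" using m[of v] \<open>v < n\<close> by simp
  show "mate v = v + n \<longleftrightarrow> mate (v + n) \<noteq> v + n"
  proof
    assume "mate (v + n) \<noteq> v + n"
    then have "mate (v + n) = v" using m[of "v + n"] \<open>v < n\<close> by (auto simp: pendant_adj_def)
    then show "mate v = v + n" using m[of "v + n"] \<open>v < n\<close> by simp
  qed (use 1 \<open>v < n\<close> in auto)
  show "mate v \<noteq> v + n \<Longrightarrow> mate v < n"
    using m[of v] \<open>v < n\<close> by (cases "mate v = v") (auto simp: pendant_adj_def)
qed

text \<open>All weight sits on the pendant vertices, and \<open>v + n\<close> is covered exactly
  when \<open>v\<close> is interdicted.\<close>

lemma interdicted_cost: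
  assumes M: "matching_on (pendant_adj n E) {..<2 * n} mate"
  shows "(\<Sum>v\<in>covered {..<2 * n} mate. pendant_weight n c v) = (\<Sum>v\<in>interdicted n mate. c v)"
proof -
  have "(\<Sum>v\<in>covered {..<2 * n} mate. pendant_weight n c v) =
      (\<Sum>v\<in>(\<lambda>v. v + n) ` interdicted n mate. pendant_weight n c v)"
  proof (rule sum.mono_neutral_right)
    show "(\<lambda>v. v + n) ` interdicted n mate \<subseteq> covered {..<2 * n} mate"
      using matching_pendant[OF M] by (auto simp: interdicted_def)
    show "\<forall>v\<in>covered {..<2 * n} mate - (\<lambda>v. v + n) ` interdicted n mate. pendant_weight n c v = 0"
    proof
      fix v assume v: "v \<in> covered {..<2 * n} mate - (\<lambda>v. v + n) ` interdicted n mate"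
      have "v < n"
      proof (rule ccontr)
        assume "\<not> v < n"
        then have "v - n < n" "v = v - n + n" using v by auto
        then have "v - n \<in> interdicted n mate"
          using matching_pendant(1)[OF M, of "v - n"] v by (auto simp: interdicted_def)
        with v \<open>v = v - n + n\<close> show False by blast
      qed
      then show "pendant_weight n c v = 0" by (simp add: pendant_weight_def)
    qed
  qed simp
  also have "\<dots> = (\<Sum>v\<in>interdicted n mate. c v)"
    by (subst sum.reindex) (auto simp: pendant_weight_def)
  finally show ?thesis .
qed

text \<open>The potential, clamped to the range allowed by the costs, is a fractional stable set scaled
  by \<open>l\<close> and bounded by the costs.\<close>

lemma fractional_stable_set_of_certificate:
  assumes bip: "bipartition (pendant_adj n E) X Y" and V: "X \<union> Y = {..<2 * n}"
    and M: "matching_on (pendant_adj n E) {..<2 * n} mate"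
    and cert: "certificate (pendant_adj n E) X Y mate (pendant_weight n c) l h" and "0 \<le> l"
  shows "\<exists>x. (\<forall>v<n. 0 \<le> x v \<and> x v \<le> int (c v) \<and> x v \<le> l) \<and>
    (\<forall>a b. a < n \<longrightarrow> b < n \<longrightarrow> a \<in> X \<longrightarrow> b \<in> Y \<longrightarrow> {a, b} \<in> E \<longrightarrow> x a + x b \<le> l) \<and>
    (\<forall>v\<in>interdicted n mate. x v = int (c v)) \<and>
    (\<forall>v<n. mate v = v \<longrightarrow> x v = l) \<and>
    (\<forall>v<n. mate v \<noteq> v \<longrightarrow> mate v < n \<longrightarrow> x v + x (mate v) = l)"
proof -
  \<comment> \<open>The formula on \<open>Y\<close> is the one on \<open>X\<close> applied to
    \<open>l - h\<close>. Clamping to the interval from 0 to \<open>l\<close> preserves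
    \<open>h a\<close> \<le> \<open>h b\<close>, which gives the edge inequality; the further cut at
    \<open>c v\<close> only lowers \<open>x\<close>.\<close>
  define x where "x v = (if v \<in> X then min (max (h v) 0) (min (int (c v)) l)
      else l - max (min (h v) l) (max 0 (l - int (c v))))" for v
  have edge: "a \<in> X \<Longrightarrow> b \<in> Y \<Longrightarrow> pendant_adj n E a b \<Longrightarrow> h a \<le> h b" for a b
    using cert by (auto simp: certificate_def)
  have hm: "h (mate v) = h v" if "v < 2 * n" for v
    using cert V that by (auto simp: certificate_def)
  have hX: "if mate v = v then l - int (pendant_weight n c v) \<le> h v
      else h v \<le> l - int (pendant_weight n c v)" if "v \<in> X" for v
    using cert that by (auto simp: certificate_def)
  have hY: "if mate v = v then h v \<le> int (pendant_weight n c v)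
      else int (pendant_weight n c v) \<le> h v" if "v \<in> Y" for v
    using cert that by (auto simp: certificate_def)
  have sides: "v \<in> X \<and> v \<notin> Y \<and> v + n \<in> Y \<and> h v \<le> h (v + n) \<or>
      v \<notin> X \<and> v \<in> Y \<and> v + n \<in> X \<and> h (v + n) \<le> h v"
    if v: "v < n" for v
  proof -
    have "pendant_adj n E v (v + n)" "pendant_adj n E (v + n) v"
      using v by (auto simp: pendant_adj_def)
    with bip edge show ?thesis unfolding bipartition_def by blast
  qed
  have w: "pendant_weight n c v = 0" "pendant_weight n c (v + n) = c v" if "v < n" for v
    using that by (auto simp: pendant_weight_def)
  show ?thesis
  proof (intro exI[of _ x] conjI allI impI ballI)
    fix v
    show "0 \<le> x v" "x v \<le> int (c v)" "x v \<le> l"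
      using \<open>0 \<le> l\<close> by (auto simp: x_def)
  next
    fix a b assume ab: "a < n" "b < n" "a \<in> X" "b \<in> Y" "{a, b} \<in> E"
    then have "h a \<le> h b" using edge by (simp add: pendant_adj_def)
    moreover have "b \<notin> X" using bip ab by (auto simp: bipartition_def)
    ultimately show "x a + x b \<le> l" using \<open>0 \<le> l\<close> ab(3) by (simp add: x_def)
  next
    fix v assume "v \<in> interdicted n mate"
    then have v: "v < n" "mate v = v + n" by (auto simp: interdicted_def)
    then have "mate v \<noteq> v" "mate (v + n) \<noteq> v + n"
      using matching_pendant[OF M v(1)] by auto
    \<comment> \<open>For \<open>v\<close> in \<open>X\<close>, the covered pendant gives
      \<open>c v\<close> \<le> \<open>h (v + n)\<close> = \<open>h v\<close>, and \<open>v\<close>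
      being covered gives \<open>h v\<close> \<le> \<open>l\<close>. The other side is the mirror
      image.\<close>
    then show "x v = int (c v)"
      using sides[OF v(1)] hm[of v] v hX[of v] hY[of v] hX[of "v + n"] hY[of "v + n"] w[OF v(1)]
      by (auto simp: x_def)
  next
    fix v assume v: "v < n" "mate v = v"
    then have "mate (v + n) = v + n"
      using matching_pendant[OF M v(1)] by auto
    \<comment> \<open>For \<open>v\<close> in \<open>X\<close>, both \<open>v\<close> and its
      pendant are free, so \<open>l\<close> \<le> \<open>h v\<close> \<le> \<open>h (v + n)\<close>
      \<le> \<open>c v\<close>.\<close>
    then show "x v = l"
      using sides[OF v(1)] v hX[of v] hY[of v] hX[of "v + n"] hY[of "v + n"] w[OF v(1)] \<open>0 \<le> l\<close>
      by (auto simp: x_def)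
  next
    fix v assume v: "v < n" "mate v \<noteq> v" "mate v < n"
    define u where "u = mate v"
    have M': "matching_on (pendant_adj n E) (X \<union> Y) mate" using M V by simp
    have u: "u < n" "mate u = v" "mate u \<noteq> u"
      using v M by (auto simp: u_def matching_on_def)
    have "mate (v + n) = v + n" "mate (u + n) = u + n"
      using matching_pendant(1)[OF M v(1)] matching_pendant(1)[OF M u(1)] u v by (auto simp: u_def)
    moreover have "h u = h v" using hm[of v] v by (simp add: u_def)
    moreover have "v \<in> X \<Longrightarrow> u \<in> Y" "v \<in> Y \<Longrightarrow> u \<in> X"
      using mate_other_side[OF bip M' v(2)] by (auto simp: u_def)
    \<comment> \<open>No clamp is active: covered ends of weight 0 confine the common potential to
      the interval from 0 to \<open>l\<close>, and the free pendants keep the values below the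
      costs. The two values are therefore the potential and its reflection.\<close>
    ultimately show "x v + x (mate v) = l"
      unfolding u_def[symmetric]
      using sides[OF v(1)] sides[OF u(1)] hX[of v] hY[of v] hX[of "v + n"] hY[of "v + n"] w[OF v(1)]
        hX[of u] hY[of u] hX[of "u + n"] hY[of "u + n"] w[OF u(1)] u v \<open>0 \<le> l\<close>
      by (auto simp: x_def)
  qed
qed

text \<open>The fractional stable set \<open>x\<close> is compared with both interdiction sets. It
  loses exactly \<open>c(R)\<close> when \<open>R\<close> is deleted and at most
  \<open>c(R')\<close> \<le> \<open>B\<close> when \<open>R'\<close> is deleted; the difference is
  less than \<open>l\<close>, the scaled value of a single vertex.\<close>

lemma certificate_imp_optimal:
  assumes G: "simple_graph {..<n} E"
    and bip: "bipartition (pendant_adj n E) X Y" and V: "X \<union> Y = {..<2 * n}"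
    and M: "matching_on (pendant_adj n E) {..<2 * n} mate"
    and cert: "certificate (pendant_adj n E) X Y mate (pendant_weight n c) l h"
    and R: "R = interdicted n mate" "(\<Sum>v\<in>R. c v) \<le> B" and l: "int B < int (\<Sum>v\<in>R. c v) + l"
  shows "optimal_interdiction_set {..<n} E c B R"
proof -
  have "0 < l" using l R by linarith
  then have "0 \<le> l" by simp
  obtain x where x: "\<forall>v<n. 0 \<le> x v \<and> x v \<le> int (c v) \<and> x v \<le> l"
    and edge: "\<forall>a b. a < n \<longrightarrow> b < n \<longrightarrow> a \<in> X \<longrightarrow> b \<in> Y \<longrightarrow> {a, b} \<in> E \<longrightarrow> x a + x b \<le> l"
    and xR: "\<forall>v\<in>interdicted n mate. x v = int (c v)"
    and free: "\<forall>v<n. mate v = v \<longrightarrow> x v = l"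
    and matched: "\<forall>v<n. mate v \<noteq> v \<longrightarrow> mate v < n \<longrightarrow> x v + x (mate v) = l"
    using fractional_stable_set_of_certificate[OF bip V M cert \<open>0 \<le> l\<close>] by blast
  have Rn: "R \<subseteq> {..<n}" using R by (auto simp: interdicted_def)
  let ?\<alpha> = "\<lambda>W. stability_number W (induced_edges E W)"
  have "?\<alpha> ({..<n} - R) \<le> ?\<alpha> ({..<n} - R')" if R': "interdiction_set {..<n} c B R'" for R'
  proof -
    have e: "e \<noteq> {}" if "e \<in> induced_edges E ({..<n} - R)" for e
      using that G by (auto simp: induced_edges_def simple_graph_def)
    then obtain S where S: "stable_set ({..<n} - R) (induced_edges E ({..<n} - R)) S"
      "card S = ?\<alpha> ({..<n} - R)"
      using stability_number_attained[of "{..<n} - R" "induced_edges E ({..<n} - R)"] by auto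
    \<comment> \<open>Each vertex of \<open>S\<close> is charged \<open>l\<close>: a free one has
      \<open>x\<close> equal to \<open>l\<close>, a matched one reaches \<open>l\<close> together
      with its mate. The mates avoid \<open>S\<close>, because \<open>S\<close> is stable, and they
      avoid \<open>R\<close>, so nothing is counted twice.\<close>
    define T where "T = {v \<in> S. mate v \<noteq> v}"
    have Sn: "S \<subseteq> {..<n} - R" using S by (simp add: stable_set_def)
    have fS: "finite S" using Sn finite_subset by blast
    have T: "v < n \<and> mate v < n \<and> mate (mate v) = v \<and> {v, mate v} \<in> E" if "v \<in> T" for v
    proof -
      have v: "v < n" "v \<notin> R" "mate v \<noteq> v" using that Sn by (auto simp: T_def)
      then have "mate v < n" using matching_pendant(3)[OF M v(1)] R by (auto simp: interdicted_def)
      moreover have "mate (mate v) = v" "pendant_adj n E v (mate v)"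
        using M v by (auto simp: matching_on_def)
      ultimately show ?thesis using v by (auto simp: pendant_adj_def)
    qed
    have mT: "mate ` T \<subseteq> {..<n} - R"
    proof
      fix u assume "u \<in> mate ` T"
      then obtain v where v: "v \<in> T" "u = mate v" by blast
      then have "u < n" "mate u = v" "v < n" using T by auto
      then show "u \<in> {..<n} - R" using R by (auto simp: interdicted_def)
    qed
    have "S \<inter> mate ` T = {}"
    proof (rule ccontr)
      assume "S \<inter> mate ` T \<noteq> {}"
      then obtain v where v: "v \<in> T" "mate v \<in> S" by blast
      then have "{v, mate v} \<subseteq> S" by (auto simp: T_def)
      moreover have "{v, mate v} \<in> induced_edges E ({..<n} - R)"
        using T[OF v(1)] \<open>{v, mate v} \<subseteq> S\<close> Sn by (auto simp: induced_edges_def)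
      ultimately show False using S(1) by (auto simp: stable_set_def)
    qed
    have "l * int (card S) = (\<Sum>v\<in>S. l)" by simp
    also have "\<dots> = (\<Sum>v\<in>S. x v + (if mate v \<noteq> v then x (mate v) else 0))"
    proof (rule sum.cong[OF refl])
      fix v assume "v \<in> S"
      then show "l = x v + (if mate v \<noteq> v then x (mate v) else 0)"
        using free matched T[of v] Sn by (auto simp: T_def)
    qed
    also have "\<dots> = (\<Sum>v\<in>S. x v) + (\<Sum>v\<in>T. x (mate v))"
      using fS by (simp add: sum.distrib sum.inter_filter T_def)
    also have "(\<Sum>v\<in>T. x (mate v)) = (\<Sum>v\<in>mate ` T. x v)"
    proof -
      have "inj_on mate T" by (rule inj_on_inverseI[of _ mate]) (use T in blast)
      then show ?thesis by (simp add: sum.reindex)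
    qed
    also have "(\<Sum>v\<in>S. x v) + (\<Sum>v\<in>mate ` T. x v) = (\<Sum>v\<in>S \<union> mate ` T. x v)"
      using fS \<open>S \<inter> mate ` T = {}\<close> by (subst sum.union_disjoint) (auto simp: T_def)
    also have "\<dots> \<le> (\<Sum>v\<in>{..<n} - R. x v)"
      using Sn mT x by (intro sum_mono2) auto
    finally have 1: "l * int (card S) \<le> (\<Sum>v\<in>{..<n} - R. x v)" .
    have 2: "(\<Sum>v\<in>{..<n} - R'. x v) \<le> l * int (?\<alpha> ({..<n} - R'))"
    proof (rule fractional_stable_set_le[of _ X Y])
      show "{..<n} - R' \<subseteq> X \<union> Y" "X \<inter> Y = {}" using V bip by (auto simp: bipartition_def)
      fix e assume e: "e \<in> E" "e \<subseteq> {..<n} - R'"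
      then have "card e = 2" using G by (auto simp: simple_graph_def)
      then obtain a b where ab: "e = {a, b}" by (auto simp: card_2_iff)
      then have adj: "pendant_adj n E a b" "a < n" "b < n" using e by (auto simp: pendant_adj_def)
      then consider "a \<in> X" "b \<in> Y" | "b \<in> X" "a \<in> Y"
        using bip by (auto simp: bipartition_def)
      then show "\<exists>a\<in>X. \<exists>b\<in>Y. e = {a, b} \<and> x a + x b \<le> l"
      proof cases
        case 1
        then show ?thesis using edge e(1) ab adj by blast
      next
        case 2
        moreover have "e = {b, a}" using ab by blast
        ultimately show ?thesis using edge e(1) adj by blast
      qed
    qed (use x \<open>0 < l\<close> in auto)
    have R'n: "R' \<subseteq> {..<n}" and cR': "(\<Sum>v\<in>R'. c v) \<le> B"
      using R' by (auto simp: interdiction_set_def)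
    have "(\<Sum>v\<in>R. x v) = int (\<Sum>v\<in>R. c v)"
      using xR R by simp
    moreover have "(\<Sum>v\<in>R'. x v) \<le> int (\<Sum>v\<in>R'. c v)"
      using x R'n by (auto intro!: sum_mono)
    moreover have "(\<Sum>v\<in>R. x v) + (\<Sum>v\<in>{..<n} - R. x v) = (\<Sum>v\<in>R'. x v) + (\<Sum>v\<in>{..<n} - R'. x v)"
      using sum.subset_diff[OF Rn, of x] sum.subset_diff[OF R'n, of x] by simp
    moreover have "int (\<Sum>v\<in>R'. c v) \<le> int B"
      using cR' by (simp only: of_nat_le_iff)
    \<comment> \<open>The strict error bound \<open>l\<close> becomes an error below 1 after
      division, which integrality turns into the desired inequality.\<close>
    ultimately have "l * int (card S) < l + l * int (?\<alpha> ({..<n} - R'))"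
      using 1 2 l by linarith
    then have "l * int (card S) < l * (1 + int (?\<alpha> ({..<n} - R')))"
      by (simp add: distrib_left)
    then have "int (card S) < 1 + int (?\<alpha> ({..<n} - R'))"
      using \<open>0 < l\<close> mult_less_cancel_left_pos by blast
    then show ?thesis using S(2) by simp
  qed
  then show ?thesis
    using R Rn by (auto simp: optimal_interdiction_set_def interdiction_set_def)
qed

section \<open>The program\<close>

definition Neq :: "aexp \<Rightarrow> aexp \<Rightarrow> bexp" where
  "Neq a b = Not (And (Not (Less a b)) (Not (Less b a)))"

definition Eq :: "aexp \<Rightarrow> aexp \<Rightarrow> bexp" where
  "Eq a b = Not (Neq a b)"

definition Or :: "bexp \<Rightarrow> bexp \<Rightarrow> bexp" where
  "Or b c = Not (And (Not b) (Not c))"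

lemma bval_connectives [simp]:
  "bval (Neq a b) s \<longleftrightarrow> aval a s \<noteq> aval b s"
  "bval (Eq a b) s \<longleftrightarrow> aval a s = aval b s"
  "bval (Or c d) s \<longleftrightarrow> bval c s \<or> bval d s"
  by (auto simp: Neq_def Eq_def Or_def)

definition num_vertices :: aexp where
  "num_vertices = Add (Read ''in'' (Const 0)) (Read ''in'' (Const 0))"

definition num_edges :: aexp where
  "num_edges = Add (Read ''in'' (Const 0)) (Read ''in'' (Const 1))"

definition visit :: "aexp \<Rightarrow> aexp \<Rightarrow> prog" where
  "visit a b =
     Cond (And (Or (Eq a (cell ''s''))
             (And (Neq (Read ''mate'' a) a) (Neq (Read ''par'' (Read ''mate'' a)) (Read ''mate'' a))))
           (Eq (Read ''par'' b) b))
       (Asg ''par'' b a) Nop"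

definition search_round :: prog where
  "search_round =
     For ''e'' (Cond (Less (cell ''e'') num_edges)
       (visit (Read ''eu'' (cell ''e'')) (Read ''ev'' (cell ''e'')) ;;
        visit (Read ''ev'' (cell ''e'')) (Read ''eu'' (cell ''e''))) Nop)"

definition clear_search :: prog where
  "clear_search =
     For ''v'' (Cond (Less (cell ''v'') num_vertices) (Asg ''par'' (cell ''v'') (cell ''v'')) Nop)"

definition search :: prog where
  "search = clear_search ;; For ''r'' search_round"

definition path_cost :: "string \<Rightarrow> string \<Rightarrow> aexp" where
  "path_cost x y = Add (Read ''w'' (cell x)) (Read ''w'' (cell y))"

definition compare_ends :: prog where
  "compare_ends =
     For ''b'' (Cond (And (And (Less (cell ''b'') num_vertices)
           (And (Eq (Read ''mate'' (cell ''b'')) (cell ''b''))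
                (Neq (Read ''par'' (cell ''b'')) (cell ''b''))))
         (Or (Neq (cell ''found'') (Const 1)) (Less (path_cost ''s'' ''b'') (path_cost ''bs'' ''be''))))
       (Asg ''bs'' (Const 0) (cell ''s'') ;; Asg ''be'' (Const 0) (cell ''b'') ;;
        Asg ''found'' (Const 0) (Const 1)) Nop)"

text \<open>All free vertices of both sides are tried as starts, because the bipartition is not
  known to the program.\<close>

definition find_cheapest :: prog where
  "find_cheapest = Asg ''found'' (Const 0) (Const 0) ;;
     For ''s'' (Cond (And (Less (cell ''s'') num_vertices) (Eq (Read ''mate'' (cell ''s'')) (cell ''s'')))
       (search ;; compare_ends) Nop)"

text \<open>The write to \<open>nxt\<close> has to come first: in the last step \<open>x\<close> is
  the free start, so \<open>nxt\<close> and \<open>x\<close> coincide and the new mate of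
  \<open>x\<close> must prevail.\<close>

definition augment :: prog where
  "augment =
     For ''k'' (Cond (Neq (cell ''cur'') (cell ''s''))
       (Asg ''x'' (Const 0) (Read ''par'' (cell ''cur'')) ;;
        Asg ''nxt'' (Const 0) (Read ''mate'' (cell ''x'')) ;;
        Asg ''mate'' (cell ''nxt'') (cell ''nxt'') ;;
        Asg ''mate'' (cell ''x'') (cell ''cur'') ;;
        Asg ''mate'' (cell ''cur'') (cell ''x'') ;;
        Asg ''cur'' (Const 0) (cell ''nxt'')) Nop)"

text \<open>The search from the best start is repeated, since searches from later starts have
  overwritten \<open>par\<close>. The guard ensures that the subtraction from \<open>rem\<close> is
  exact.\<close>

definition improve :: prog where
  "improve = find_cheapest ;;
     Cond (And (Eq (cell ''found'') (Const 1)) (Not (Less (cell ''rem'') (path_cost ''bs'' ''be''))))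
       (Asg ''rem'' (Const 0) (Sub (cell ''rem'') (path_cost ''bs'' ''be'')) ;;
        Asg ''s'' (Const 0) (cell ''bs'') ;; search ;;
        Asg ''cur'' (Const 0) (cell ''be'') ;; augment) Nop"

text \<open>In the input, the costs begin at address 3 and the edges at address
  \<open>3 + n\<close>. The pendant edge of vertex v becomes edge number \<open>m + v\<close>,
  written when the counter is at \<open>v + n\<close>. The weights of original vertices are never
  written and keep their initial value 0.\<close>

definition initialize :: prog where
  "initialize = Asg ''rem'' (Const 0) (Read ''in'' (Const 2)) ;;
     For ''i'' (
       Cond (Less (cell ''i'') (Read ''in'' (Const 1)))
         (Asg ''eu'' (cell ''i'')
            (Read ''in'' (Add (Const 3) (Add (Read ''in'' (Const 0)) (Add (cell ''i'') (cell ''i''))))) ;;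
          Asg ''ev'' (cell ''i'')
            (Read ''in'' (Add (Const 4) (Add (Read ''in'' (Const 0)) (Add (cell ''i'') (cell ''i'')))))) Nop ;;
       Cond (Less (cell ''i'') num_vertices)
         (Asg ''mate'' (cell ''i'') (cell ''i'') ;;
          Cond (Less (cell ''i'') (Read ''in'' (Const 0))) Nop
            (Asg ''eu'' (Sub (Add (Read ''in'' (Const 1)) (cell ''i'')) (Read ''in'' (Const 0)))
               (Sub (cell ''i'') (Read ''in'' (Const 0))) ;;
             Asg ''ev'' (Sub (Add (Read ''in'' (Const 1)) (cell ''i'')) (Read ''in'' (Const 0))) (cell ''i'') ;;
             Asg ''w'' (cell ''i'') (Read ''in'' (Sub (Add (Const 3) (cell ''i'')) (Read ''in'' (Const 0)))))) Nop)"

text \<open>The length of the output is counted downwards in \<open>d\<close>, since sums are not stored.\<close>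

definition write_output :: prog where
  "write_output = Asg ''d'' (Const 0) (cell ''inlen'') ;;
     For ''i'' (Cond (And (Less (cell ''i'') (Read ''in'' (Const 0)))
         (Eq (Read ''mate'' (cell ''i'')) (Add (cell ''i'') (Read ''in'' (Const 0)))))
       (Asg ''out'' (Sub (cell ''inlen'') (cell ''d'')) (cell ''i'') ;;
        Asg ''d'' (Const 0) (Sub (cell ''d'') (Const 1))) Nop) ;;
     Asg ''outlen'' (Const 0) (Sub (cell ''inlen'') (cell ''d''))"

definition interdict :: prog where
  "interdict = initialize ;; For ''j'' improve ;; write_output"

lemmas prog_defs = visit_def search_round_def clear_search_def search_def compare_ends_def
  find_cheapest_def augment_def improve_def initialize_def write_output_def interdict_def

lemma well_formed_interdict: "well_formed interdict"
  by (simp add: prog_defs)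

lemma written_search: "written search = {''par'', ''v'', ''r'', ''e''}"
  by (auto simp: prog_defs)

lemma written_clear_search: "written clear_search = {''par'', ''v''}"
  by (auto simp: prog_defs)

lemma written_search_round: "written search_round = {''par'', ''e''}"
  by (auto simp: prog_defs)

lemma written_compare_ends: "written compare_ends = {''b'', ''bs'', ''be'', ''found''}"
  by (auto simp: prog_defs)

lemma written_find_cheapest:
  "written find_cheapest = {''par'', ''v'', ''r'', ''e'', ''b'', ''bs'', ''be'', ''found'', ''s''}"
  by (auto simp: find_cheapest_def written_search written_compare_ends)

lemma written_augment: "written augment = {''k'', ''x'', ''nxt'', ''mate'', ''cur''}"
  by (auto simp: prog_defs)

lemma written_improve:
  "written improve = {''par'', ''v'', ''r'', ''e'', ''b'', ''bs'', ''be'', ''found'', ''s'', ''rem'',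
     ''k'', ''x'', ''nxt'', ''mate'', ''cur''}"
  by (auto simp: improve_def written_search written_augment written_find_cheapest)

section \<open>Effect of the program on the store; the search phase\<close>

lemma set_cell_simps [simp]:
  "y \<noteq> x \<Longrightarrow> set_cell x i s y = s y"
  "set_cell x i s x 0 = i"
  by (auto simp: set_cell_def)

lemma run_visit:
  "run (visit a b) s =
    s(''par'' := if outer (s ''mate'') (s ''s'' 0) (s ''par'') (aval a s) \<and> s ''par'' (aval b s) = aval b s
     then (s ''par'')(aval b s := aval a s) else s ''par'')"
  by (simp add: visit_def outer_def)

lemma run_Cond:
  "bval c s \<Longrightarrow> run (Cond c p q) s = run p s"
  "\<not> bval c s \<Longrightarrow> run (Cond c p q) s = run q s"
  by simp_all

text \<open>Strictness of \<open>n < l\<close> matters: \<open>2 * l\<close> rounds exceed the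
  number \<open>2 * n\<close> of vertices, so a set of vertices that grows in every unfinished round
  must be finished when its loop ends.\<close>

locale network =
  fixes n m l :: nat and eu ev w :: "nat \<Rightarrow> nat" and A :: "nat \<Rightarrow> nat \<Rightarrow> bool"
  assumes n_less: "n < l" and edges_le: "n + m \<le> l"
    and edge_iff: "A a b \<longleftrightarrow> (\<exists>e<n + m. a = eu e \<and> b = ev e \<or> a = ev e \<and> b = eu e)"
    and edge_vertices: "A a b \<Longrightarrow> a < 2 * n \<and> b < 2 * n \<and> a \<noteq> b"
begin

abbreviation V :: "nat set" where
  "V \<equiv> {..<2 * n}"

definition env :: "store \<Rightarrow> bool" where
  "env s \<longleftrightarrow> s ''in'' 0 = n \<and> s ''in'' (Suc 0) = m \<and> s ''inlen'' 0 = l \<and> s ''eu'' = eu \<and> s ''ev'' = ev \<and>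
     s ''w'' = w"

lemma env_run:
  assumes "{''in'', ''inlen'', ''eu'', ''ev'', ''w''} \<inter> written p = {}"
  shows "env (run p s) \<longleftrightarrow> env s"
  using assms by (simp add: env_def run_frame)

lemma env_upd:
  assumes "x \<notin> {''in'', ''inlen'', ''eu'', ''ev'', ''w''}"
  shows "env (s(x := f)) \<longleftrightarrow> env s" "env (set_cell x i s) \<longleftrightarrow> env s"
  using assms by (auto simp: env_def)

lemma symp_A: "symp A"
  unfolding symp_def edge_iff by blast

lemma aval_bounds:
  assumes "env s"
  shows "aval num_vertices s = 2 * n" "aval num_edges s = n + m"
  using assms by (auto simp: env_def num_vertices_def num_edges_def)

definition search_closed :: "(nat \<Rightarrow> nat) \<Rightarrow> nat \<Rightarrow> (nat \<Rightarrow> nat) \<Rightarrow> bool" where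
  "search_closed mate s par \<longleftrightarrow> (\<forall>a b. A a b \<longrightarrow> outer mate s par a \<longrightarrow> par b \<noteq> b)"

text \<open>The clause that \<open>par\<close> was not closed before a proper extension implies that
  a closed search is left unchanged by all later rounds.\<close>

definition search_extends :: "(nat \<Rightarrow> nat) \<Rightarrow> nat \<Rightarrow> (nat \<Rightarrow> nat) \<Rightarrow> (nat \<Rightarrow> nat) \<Rightarrow> bool" where
  "search_extends mate s par par' \<longleftrightarrow> (\<exists>rk. search_tree A V mate s par' rk) \<and>
     (par' = par \<or> card (covered V par) < card (covered V par') \<and> \<not> search_closed mate s par)"

lemma search_extends_visit:
  assumes "search_extends mate s par par1" "A a b" "matching_on A V mate"
    and par2: "par2 = (if outer mate s par1 a \<and> par1 b = b then par1(b := a) else par1)"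
  shows "search_extends mate s par par2"
    and "par2 = par \<Longrightarrow> par1 = par \<and> (outer mate s par a \<longrightarrow> par b \<noteq> b)"
proof -
  have ab: "a \<in> V" "b \<in> V" "a \<noteq> b" using edge_vertices[OF assms(2)] by auto
  have mV: "mate a \<in> V" using assms(3) ab by (auto simp: matching_on_def)
  obtain rk where rk: "search_tree A V mate s par1 rk"
    using assms(1) by (auto simp: search_extends_def)
  have "search_extends mate s par par2 \<and>
    (par2 = par \<longrightarrow> par1 = par \<and> (outer mate s par a \<longrightarrow> par b \<noteq> b))"
  proof (cases "outer mate s par1 a \<and> par1 b = b")
    case True
    note ext = search_tree_extend[OF rk _ ab(2) _ assms(2) ab(3) _ mV]
    have "\<exists>rk. search_tree A V mate s par2 rk" and c: "card (covered V par2) = Suc (card (covered V par1))"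
      using ext True par2 by auto
    moreover have "par1 = par \<Longrightarrow> \<not> search_closed mate s par"
      using True assms(2) by (auto simp: search_closed_def)
    moreover have "par2 \<noteq> par"
      using c assms(1) by (auto simp: search_extends_def)
    ultimately show ?thesis
      using assms(1) by (auto simp: search_extends_def)
  next
    case False
    then show ?thesis using par2 assms(1) by auto
  qed
  then show "search_extends mate s par par2"
    and "par2 = par \<Longrightarrow> par1 = par \<and> (outer mate s par a \<longrightarrow> par b \<noteq> b)"
    by blast+
qed

lemma run_search_round:
  assumes s: "env s" and M: "matching_on A V (s ''mate'')"
    and tree: "\<exists>rk. search_tree A V (s ''mate'') (s ''s'' 0) (s ''par'') rk"
  shows "search_extends (s ''mate'') (s ''s'' 0) (s ''par'') (run search_round s ''par'') \<and>
    (run search_round s ''par'' = s ''par'' \<longrightarrow> search_closed (s ''mate'') (s ''s'' 0) (s ''par''))"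
proof -
  let ?mate = "s ''mate''" and ?s = "s ''s'' 0" and ?par = "s ''par''"
  let ?closed = "\<lambda>a b. outer ?mate ?s ?par a \<longrightarrow> ?par b \<noteq> b"
  define I where "I i t \<longleftrightarrow> env t \<and> t ''mate'' = ?mate \<and> t ''s'' 0 = ?s \<and>
    search_extends ?mate ?s ?par (t ''par'') \<and>
    (t ''par'' = ?par \<longrightarrow> (\<forall>e<n + m. e < i \<longrightarrow> ?closed (eu e) (ev e) \<and> ?closed (ev e) (eu e)))"
    for i :: nat and t :: store
  have I_upd: "I i (set_cell ''e'' j t) = I i t" for i j t
    by (simp add: I_def env_upd)
  have "I (2 * l) (run search_round s)"
    unfolding search_round_def
  proof (rule run_For)
    show "s ''inlen'' 0 = l" using s by (simp add: env_def)
    show "I 0 (set_cell ''e'' 0 s)"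
      unfolding I_upd using s tree by (simp add: I_def search_extends_def)
  next
    fix i t assume t: "t ''inlen'' 0 = l" "t ''e'' 0 = i" "I i t"
    let ?body = "visit (Read ''eu'' (cell ''e'')) (Read ''ev'' (cell ''e'')) ;;
        visit (Read ''ev'' (cell ''e'')) (Read ''eu'' (cell ''e''))"
    have env: "env t" and tm: "t ''mate'' = ?mate" "t ''s'' 0 = ?s" using t by (auto simp: I_def)
    have eu: "t ''eu'' = eu" "t ''ev'' = ev" using env by (auto simp: env_def)
    have "I (Suc i) (run (Cond (Less (cell ''e'') num_edges) ?body Nop) t)"
    proof (cases "i < n + m")
      case False
      then show ?thesis using t aval_bounds[OF env] by (auto simp: I_def less_Suc_eq)
    next
      case True
      then have A1: "A (eu i) (ev i)" and A2: "A (ev i) (eu i)"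
        using edge_iff by blast+
      define p1 where "p1 = (if outer ?mate ?s (t ''par'') (eu i) \<and> t ''par'' (ev i) = ev i
        then (t ''par'')(ev i := eu i) else t ''par'')"
      define p2 where "p2 = (if outer ?mate ?s p1 (ev i) \<and> p1 (eu i) = eu i
        then p1(eu i := ev i) else p1)"
      have ext: "search_extends ?mate ?s ?par (t ''par'')" using t by (simp add: I_def)
      note step1 = search_extends_visit[OF ext A1 M p1_def]
      note step2 = search_extends_visit[OF step1(1) A2 M p2_def]
      define u where "u = run (visit (Read ''eu'' (cell ''e'')) (Read ''ev'' (cell ''e''))) t"
      have u: "u = t(''par'' := p1)"
        unfolding u_def run_visit using t(2) tm eu by (simp add: p1_def)
      have "run ?body t = t(''par'' := p2)"
        unfolding run.simps(3) u_def[symmetric] unfolding u run_visit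
        using t(2) tm eu by (simp add: p2_def)
      then have r: "run (Cond (Less (cell ''e'') num_edges) ?body Nop) t = t(''par'' := p2)"
        using True t(2) aval_bounds[OF env] by simp
      have "?closed (eu e) (ev e) \<and> ?closed (ev e) (eu e)"
        if "p2 = ?par" "e < n + m" "e < Suc i" for e
        using that step1(2) step2(2) t(3) by (auto simp: I_def less_Suc_eq)
      then show ?thesis
        unfolding r using step2(1) env tm by (simp add: I_def env_upd)
    qed
    then show "I (Suc i) (set_cell ''e'' (Suc i) (run (Cond (Less (cell ''e'') num_edges) ?body Nop) t))"
      by (simp only: I_upd)
  qed (simp_all add: visit_def)
  moreover have "search_closed ?mate ?s ?par"
    if "\<forall>e<n + m. e < 2 * l \<longrightarrow> ?closed (eu e) (ev e) \<and> ?closed (ev e) (eu e)"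
    unfolding search_closed_def edge_iff using that edges_le by auto
  ultimately show ?thesis by (auto simp: I_def)
qed

lemma run_clear_search:
  assumes "env s" "v < 2 * n"
  shows "run clear_search s ''par'' v = v"
proof -
  define I where "I i t \<longleftrightarrow> env t \<and> (\<forall>v<2 * n. v < i \<longrightarrow> t ''par'' v = v)" for i :: nat and t :: store
  have I_upd: "I i (set_cell ''v'' j t) = I i t" for i j t
    by (simp add: I_def env_upd)
  have "I (2 * l) (run clear_search s)"
    unfolding clear_search_def
  proof (rule run_For)
    show "s ''inlen'' 0 = l" using assms by (simp add: env_def)
    show "I 0 (set_cell ''v'' 0 s)"
      unfolding I_upd using assms by (simp add: I_def)
  next
    fix i t assume t: "t ''v'' 0 = i" "I i t"
    then have "env t" by (simp add: I_def)
    then show "I (Suc i) (set_cell ''v'' (Suc i)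
        (run (Cond (Less (cell ''v'') num_vertices) (Asg ''par'' (cell ''v'') (cell ''v'')) Nop) t))"
      unfolding I_upd using t aval_bounds[of t] by (auto simp: I_def env_upd less_Suc_eq)
  qed simp_all
  then show ?thesis using assms n_less by (simp add: I_def)
qed

lemma run_search:
  assumes s: "env s" and M: "matching_on A V (s ''mate'')"
  obtains rk where "search_tree A V (s ''mate'') (s ''s'' 0) (run search s ''par'') rk"
    and "\<And>b. b \<in> V \<and> run search s ''par'' b \<noteq> b \<longleftrightarrow> b \<in> alt_reach A (s ''mate'') (s ''s'' 0)"
proof -
  let ?mate = "s ''mate''" and ?s = "s ''s'' 0"
  let ?par = "run search s ''par''"
  define s1 where "s1 = run clear_search s"
  have s1: "env s1" "s1 ''mate'' = ?mate" "s1 ''s'' 0 = ?s"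
    using s by (simp_all add: s1_def env_run run_frame written_clear_search)
  \<comment> \<open>Each round that starts from an unclosed search discovers a vertex, so the second
    disjunct fails once \<open>i\<close> exceeds the number of vertices.\<close>
  define I where "I i t \<longleftrightarrow> env t \<and> t ''mate'' = ?mate \<and> t ''s'' 0 = ?s \<and>
    (\<exists>rk. search_tree A V ?mate ?s (t ''par'') rk) \<and>
    (search_closed ?mate ?s (t ''par'') \<or> i \<le> card (covered V (t ''par'')))"
    for i :: nat and t :: store
  have I_upd: "I i (set_cell ''r'' j t) = I i t" for i j t
    by (simp add: I_def env_upd)
  have "I (2 * l) (run (For ''r'' search_round) s1)"
  proof (rule run_For)
    show "s1 ''inlen'' 0 = l" using s1 by (simp add: env_def)
    have "search_tree A V ?mate ?s (s1 ''par'') rk" for rk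
      using run_clear_search[OF s] by (simp add: search_tree_def s1_def)
    then show "I 0 (set_cell ''r'' 0 s1)"
      unfolding I_upd using s1 by (simp add: I_def)
  next
    fix i t assume t: "I i t"
    then have env: "env t" and tm: "t ''mate'' = ?mate" "t ''s'' 0 = ?s" by (auto simp: I_def)
    have "env (run search_round t)" "run search_round t ''mate'' = ?mate" "run search_round t ''s'' 0 = ?s"
      using env tm by (simp_all add: env_run run_frame written_search_round)
    then show "I (Suc i) (set_cell ''r'' (Suc i) (run search_round t))"
      unfolding I_upd using run_search_round[OF env, unfolded tm, OF M] t
      by (auto simp: I_def search_extends_def)
  qed (simp_all add: written_search_round)
  then have I: "I (2 * l) (run search s)" by (simp add: search_def s1_def)
  have "card (covered V ?par) \<le> card V" by (intro card_mono) auto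
  then have "search_closed ?mate ?s ?par" using I n_less by (auto simp: I_def)
  moreover obtain rk where rk: "search_tree A V ?mate ?s ?par rk" using I by (auto simp: I_def)
  ultimately have "b \<in> V \<and> ?par b \<noteq> b \<longleftrightarrow> b \<in> alt_reach A ?mate ?s" for b
    using search_tree_sound[OF rk M] search_tree_complete[OF _ M, where par = ?par and s = ?s and b = b]
      edge_vertices by (auto simp: search_closed_def)
  with rk show ?thesis using that by blast
qed


section \<open>Cheapest augmenting pairs and successive augmentation\<close>

definition augmenting_pairs :: "(nat \<Rightarrow> nat) \<Rightarrow> (nat \<times> nat) set" where
  "augmenting_pairs mate = {(a, b). a \<in> V \<and> mate a = a \<and> b \<in> alt_reach A mate a \<and> mate b = b}"

text \<open>\<open>F\<close> holds the pairs examined so far. A flag is needed because every value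
  of \<open>bs\<close> and \<open>be\<close>, including 0, may be a vertex.\<close>

definition cheapest_among :: "(nat \<times> nat) set \<Rightarrow> store \<Rightarrow> bool" where
  "cheapest_among F t \<longleftrightarrow>
     (t ''found'' 0 = 1 \<longrightarrow> (t ''bs'' 0, t ''be'' 0) \<in> augmenting_pairs (t ''mate'')) \<and>
     (\<forall>(a, b)\<in>F. t ''found'' 0 = 1 \<and> w (t ''bs'' 0) + w (t ''be'' 0) \<le> w a + w b)"

lemma cheapest_among_set_cell:
  "x \<notin> {''found'', ''bs'', ''be'', ''mate''} \<Longrightarrow> cheapest_among F (set_cell x i t) = cheapest_among F t"
  by (auto simp: cheapest_among_def set_cell_def)

lemma alt_reach_subset: "alt_reach A mate a \<subseteq> V"
  using edge_vertices by (auto elim: alt_reach.cases)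

lemma run_compare_ends:
  assumes s: "env s" and a: "s ''s'' 0 = a" "a \<in> V" "s ''mate'' a = a"
    and par: "\<And>b. b \<in> V \<and> s ''par'' b \<noteq> b \<longleftrightarrow> b \<in> alt_reach A (s ''mate'') a"
    and F: "cheapest_among F s"
  shows "cheapest_among (F \<union> {(a', b) \<in> augmenting_pairs (s ''mate''). a' = a}) (run compare_ends s)"
proof -
  let ?mate = "s ''mate''"
  define G where "G i = F \<union> {(a', b) \<in> augmenting_pairs ?mate. a' = a \<and> b < i}" for i
  define I where "I i t \<longleftrightarrow> env t \<and> t ''mate'' = ?mate \<and> t ''s'' 0 = a \<and> t ''par'' = s ''par'' \<and>
    cheapest_among (G i) t" for i :: nat and t :: store
  have I_upd: "I i (set_cell ''b'' j t) = I i t" for i j t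
    by (simp add: I_def env_upd cheapest_among_set_cell)
  have G_Suc: "G (Suc i) = (if (a, i) \<in> augmenting_pairs ?mate then insert (a, i) (G i) else G i)" for i
    by (auto simp: G_def less_Suc_eq)
  have "I (2 * l) (run compare_ends s)"
    unfolding compare_ends_def
  proof (rule run_For)
    show "s ''inlen'' 0 = l" using s by (simp add: env_def)
    have "G 0 = F" by (simp add: G_def)
    then show "I 0 (set_cell ''b'' 0 s)"
      unfolding I_upd using s a F by (simp add: I_def)
  next
    fix i t assume t: "t ''b'' 0 = i" "I i t"
    then have env: "env t" and tm: "t ''mate'' = ?mate" "t ''s'' 0 = a" "t ''par'' = s ''par''"
      and ch: "cheapest_among (G i) t"
      by (auto simp: I_def)
    have tw: "t ''w'' = w" using env by (simp add: env_def)
    let ?better = "(t ''found'' 0 = 1 \<longrightarrow> w a + w i < w (t ''bs'' 0) + w (t ''be'' 0))"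
    let ?p = "Asg ''bs'' (Const 0) (cell ''s'') ;; Asg ''be'' (Const 0) (cell ''b'') ;;
        Asg ''found'' (Const 0) (Const 1)"
    let ?c = "And (And (Less (cell ''b'') num_vertices)
           (And (Eq (Read ''mate'' (cell ''b'')) (cell ''b''))
                (Neq (Read ''par'' (cell ''b'')) (cell ''b''))))
         (Or (Neq (cell ''found'') (Const 1)) (Less (path_cost ''s'' ''b'') (path_cost ''bs'' ''be'')))"
    have pair: "(a, i) \<in> augmenting_pairs ?mate \<longleftrightarrow> i \<in> V \<and> ?mate i = i \<and> s ''par'' i \<noteq> i"
      using a par[of i] by (auto simp: augmenting_pairs_def)
    then have c: "bval ?c t \<longleftrightarrow> (a, i) \<in> augmenting_pairs ?mate \<and> ?better"
      using t(1) tm tw aval_bounds[OF env] by (auto simp: path_cost_def)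
    have "I (Suc i) (run (Cond ?c ?p Nop) t)"
    proof (cases "bval ?c t")
      case False
      then have "cheapest_among (G (Suc i)) t"
        using ch c tm(1) by (auto simp: G_Suc cheapest_among_def)
      then show ?thesis unfolding run_Cond(2)[OF False] using env tm by (simp add: I_def)
    next
      case True
      define u where "u = run ?p t"
      have u: "u ''bs'' 0 = a" "u ''be'' 0 = i" "u ''found'' 0 = 1" "u ''mate'' = ?mate" "u ''s'' 0 = a"
        "u ''par'' = s ''par''"
        using t(1) tm by (simp_all add: u_def)
      have "env u" using env by (simp add: u_def env_upd)
      moreover have "cheapest_among (G (Suc i)) u"
        using ch u c True by (fastforce simp: G_Suc cheapest_among_def)
      ultimately have "I (Suc i) u" using u by (simp add: I_def)
      then show ?thesis unfolding run_Cond(1)[OF True] by (simp add: u_def)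
    qed
    then show "I (Suc i) (set_cell ''b'' (Suc i) (run (Cond ?c ?p Nop) t))"
      by (simp only: I_upd)
  qed simp_all
  moreover have "G (2 * l) = F \<union> {(a', b) \<in> augmenting_pairs ?mate. a' = a}"
    using alt_reach_subset n_less by (fastforce simp: G_def augmenting_pairs_def)
  ultimately show ?thesis by (simp add: I_def)
qed

lemma run_find_cheapest:
  assumes s: "env s" and M: "matching_on A V (s ''mate'')"
  shows "cheapest_among (augmenting_pairs (s ''mate'')) (run find_cheapest s)"
proof -
  let ?mate = "s ''mate''"
  define G where "G i = {(a, b) \<in> augmenting_pairs ?mate. a < i}" for i
  define I where "I i t \<longleftrightarrow> env t \<and> t ''mate'' = ?mate \<and> cheapest_among (G i) t" for i :: nat and t :: store
  have I_upd: "I i (set_cell ''s'' j t) = I i t" for i j t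
    by (simp add: I_def env_upd cheapest_among_set_cell)
  define s1 where "s1 = run (Asg ''found'' (Const 0) (Const 0)) s"
  have s1: "env s1" "s1 ''found'' 0 = 0" "s1 ''mate'' = ?mate" using s by (simp_all add: s1_def env_upd)
  let ?c = "And (Less (cell ''s'') num_vertices) (Eq (Read ''mate'' (cell ''s'')) (cell ''s''))"
  have "I (2 * l) (run (For ''s'' (Cond ?c (search ;; compare_ends) Nop)) s1)"
  proof (rule run_For)
    show "s1 ''inlen'' 0 = l" using s1 by (simp add: env_def)
    show "I 0 (set_cell ''s'' 0 s1)"
      unfolding I_upd using s1 by (simp add: I_def G_def cheapest_among_def)
  next
    fix i t assume t: "t ''s'' 0 = i" "I i t"
    then have env: "env t" and tm: "t ''mate'' = ?mate" and ch: "cheapest_among (G i) t"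
      by (auto simp: I_def)
    have c: "bval ?c t \<longleftrightarrow> i \<in> V \<and> ?mate i = i"
      using t(1) tm aval_bounds[OF env] by simp
    have "I (Suc i) (run (Cond ?c (search ;; compare_ends) Nop) t)"
    proof (cases "bval ?c t")
      case False
      then have "G (Suc i) = G i"
        using c by (auto simp: G_def less_Suc_eq augmenting_pairs_def)
      then show ?thesis unfolding run_Cond(2)[OF False] using env tm ch by (simp add: I_def)
    next
      case True
      define u where "u = run search t"
      have u: "env u" "u ''mate'' = ?mate" "u ''s'' 0 = i" "cheapest_among (G i) u"
        using env tm t(1) ch
        by (simp_all add: u_def env_run run_frame written_search cheapest_among_def)
      have M': "matching_on A V (t ''mate'')" using M tm by simp
      obtain rk where "\<And>b. b \<in> V \<and> u ''par'' b \<noteq> b \<longleftrightarrow> b \<in> alt_reach A ?mate i"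
        using run_search[OF env M'] unfolding u_def tm t(1) by metis
      then have "cheapest_among (G i \<union> {(a', b) \<in> augmenting_pairs (u ''mate''). a' = i}) (run compare_ends u)"
        using True[unfolded c] u by (intro run_compare_ends) auto
      moreover have "G i \<union> {(a', b) \<in> augmenting_pairs ?mate. a' = i} = G (Suc i)"
        by (auto simp: G_def)
      moreover have "env (run compare_ends u)" "run compare_ends u ''mate'' = ?mate"
        using u by (simp_all add: env_run run_frame written_compare_ends)
      ultimately show ?thesis unfolding run_Cond(1)[OF True] using u by (simp add: I_def u_def)
    qed
    then show "I (Suc i) (set_cell ''s'' (Suc i) (run (Cond ?c (search ;; compare_ends) Nop) t))"
      by (simp only: I_upd)
  qed (simp_all add: written_search written_compare_ends)
  moreover have "run (For ''s'' (Cond ?c (search ;; compare_ends) Nop)) s1 = run find_cheapest s"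
    by (simp add: find_cheapest_def s1_def)
  moreover have "G (2 * l) = augmenting_pairs ?mate"
    using n_less by (auto simp: G_def augmenting_pairs_def)
  ultimately show ?thesis by (simp add: I_def)
qed

text \<open>By complementary slackness such a matching has the least covered weight among all
  matchings of its size. Sides, multiplier and potential are hidden because they change from round
  to round.\<close>

definition extreme :: "(nat \<Rightarrow> nat) \<Rightarrow> bool" where
  "extreme mate \<longleftrightarrow> matching_on A V mate \<and>
     (\<exists>X Y k h. bipartition A X Y \<and> X \<union> Y = V \<and> certificate A X Y mate w k h)"

text \<open>Used twice: before an augmentation with \<open>k\<close> the cost of the cheapest pair,
  and at the end with \<open>k\<close> one more than the remaining budget. \<open>a0\<close> is a
  vertex that should lie in \<open>X\<close>.\<close>

lemma extreme_raise:
  assumes "extreme mate" and cost: "\<forall>(a, b)\<in>augmenting_pairs mate. k \<le> int (w a + w b)"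
  obtains X Y k' h where "bipartition A X Y" "X \<union> Y = V" "certificate A X Y mate w k' h" "k \<le> k'"
    and "\<forall>(a, b)\<in>augmenting_pairs mate. k' \<le> int (w a + w b)" and "a0 \<in> V \<longrightarrow> a0 \<in> X"
proof -
  have M: "matching_on A V mate" using assms(1) by (simp add: extreme_def)
  obtain X0 Y0 k0 h0 where h0: "bipartition A X0 Y0" "X0 \<union> Y0 = V" "certificate A X0 Y0 mate w k0 h0"
    using assms(1) by (auto simp: extreme_def)
  have "\<exists>X Y h. bipartition A X Y \<and> X \<union> Y = V \<and> certificate A X Y mate w k0 h \<and> (a0 \<in> V \<longrightarrow> a0 \<in> X)"
  proof (cases "a0 \<in> X0")
    case True
    with h0 show ?thesis by blast
  next
    case False
    have "Y0 \<union> X0 = V" "a0 \<in> V \<longrightarrow> a0 \<in> Y0" using h0(2) False by blast+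
    then show ?thesis using bipartition_swap[OF h0(1)] certificate_swap[OF h0(1,3)] by blast
  qed
  then obtain X Y h where bip: "bipartition A X Y" and XY: "X \<union> Y = V"
    and cert: "certificate A X Y mate w k0 h" and a0: "a0 \<in> V \<longrightarrow> a0 \<in> X"
    by blast
  have M': "matching_on A (X \<union> Y) mate" "matching_on A (Y \<union> X) mate"
    using M XY by (simp_all add: Un_commute)
  \<comment> \<open>The present multiplier already obeys weak duality for starts on both sides, so
    the maximum of \<open>k0\<close> and \<open>k\<close> does as well.\<close>
  have k0: "k0 \<le> int (w a + w b)" if ab: "(a, b) \<in> augmenting_pairs mate" for a b
  proof -
    have "a \<in> X \<or> a \<in> Y" "mate a = a" "b \<in> alt_reach A mate a" "mate b = b"
      using ab XY by (auto simp: augmenting_pairs_def)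
    then show ?thesis
      using augmenting_cost_ge[OF bip M'(1) cert]
        augmenting_cost_ge[OF bipartition_swap[OF bip] M'(2) certificate_swap[OF bip cert]] by blast
  qed
  define k' where "k' = max k0 k"
  have k': "\<forall>(a, b)\<in>augmenting_pairs mate. k' \<le> int (w a + w b)"
    using k0 cost by (auto simp: k'_def)
  have "finite X" using XY by (metis finite_Un finite_lessThan)
  moreover have "k' \<le> int (w a + w b)"
    if "a \<in> X" "mate a = a" "b \<in> alt_reach A mate a" "mate b = b" for a b
  proof -
    have "(a, b) \<in> augmenting_pairs mate"
      using that XY by (auto simp: augmenting_pairs_def)
    then show ?thesis using k' by blast
  qed
  ultimately obtain h' where "certificate A X Y mate w k' h'"
    using certificate_raise[OF bip M'(1) _ cert, of k'] by (auto simp: k'_def)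
  then show ?thesis
    using that[OF bip XY _ _ k' a0] by (simp add: k'_def)
qed

text \<open>With the multiplier raised to the cost of the cheapest pair, the bounds at both ends are
  tight. The potential of the old matching then certifies the new one as well, since the newly
  covered ends satisfy the reversed inequalities with equality.\<close>

lemma extreme_augment:
  assumes ex: "extreme mate" and ab: "(a, b) \<in> augmenting_pairs mate"
    and cheap: "\<forall>(a', b')\<in>augmenting_pairs mate. w a + w b \<le> w a' + w b'"
    and tree: "search_tree A V mate a par rk"
    and reach: "\<And>b. b \<in> V \<and> par b \<noteq> b \<longleftrightarrow> b \<in> alt_reach A mate a"
  obtains h k where "a \<noteq> b"
    and "augmentation_state A V (covered V mate) a b par rk h k mate b"
    and "\<And>b. b \<in> V \<Longrightarrow> par b \<noteq> b \<Longrightarrow> A (par b) b \<and> k \<le> h (par b) \<and> h (par b) \<le> h b \<and> par (par b) = par b"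
    and "\<And>mate'. augmentation_state A V (covered V mate) a b par rk h k mate' a \<Longrightarrow> extreme mate'"
proof -
  have M: "matching_on A V mate" using ex by (simp add: extreme_def)
  have av: "a \<in> V" "mate a = a" "b \<in> alt_reach A mate a" "mate b = b"
    using ab by (auto simp: augmenting_pairs_def)
  have bv: "b \<in> V" using av alt_reach_subset by blast
  obtain X Y k h where bip: "bipartition A X Y" and XY: "X \<union> Y = V"
    and cert: "certificate A X Y mate w k h" "int (w a + w b) \<le> k" and aX: "a \<in> X"
    and le: "\<forall>(a, b)\<in>augmenting_pairs mate. k \<le> int (w a + w b)"
  proof (rule extreme_raise[OF ex])
    show "\<forall>(a', b')\<in>augmenting_pairs mate. int (w a + w b) \<le> int (w a' + w b')"
      using cheap by auto
  qed (use av(1) in blast)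
  have k: "k = int (w a + w b)" using cert(2) le ab by fastforce
  have M': "matching_on A (X \<union> Y) mate" using M XY by simp
  note pot = alt_reach_potential[OF bip M' cert(1) aX]
  have bY: "b \<in> Y" "h a \<le> h b" using pot[OF av(3)] by auto
  \<comment> \<open>Together with \<open>h a\<close> \<le> \<open>h b\<close> and \<open>k\<close> =
    \<open>w a + w b\<close>, this squeezes both values to \<open>w b\<close>.\<close>
  have "k - int (w a) \<le> h a" "h b \<le> int (w b)"
    using cert(1) aX bY av by (auto simp: certificate_def)
  then have hab: "h a = int (w b)" "h b = int (w b)" using k bY by auto
  have disj: "X \<inter> Y = {}" using bip by (simp add: bipartition_def)
  have ne: "a \<noteq> b" using aX bY disj by auto
  have hm: "\<forall>v\<in>V. h (mate v) = h v" using cert(1) XY by (simp add: certificate_def)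
  have par: "A (par c) c \<and> h a \<le> h (par c) \<and> h (par c) \<le> h c \<and> par (par c) = par c"
    if c: "c \<in> V" "par c \<noteq> c" for c
  proof -
    have "c \<in> Y" using pot reach c by blast
    have A: "A (par c) c" using tree c by (simp add: search_tree_def)
    then have pX: "par c \<in> X" using bip \<open>c \<in> Y\<close> by (auto simp: bipartition_def)
    then have pV: "par c \<in> V" using XY by blast
    have "h (par c) \<le> h c" using cert(1) pX \<open>c \<in> Y\<close> A by (auto simp: certificate_def)
    moreover have "par (par c) = par c"
      using reach[of "par c"] pot[of "par c"] pV pX disj by blast
    moreover have "h a \<le> h (par c)"
    proof (cases "par c = a")
      case False
      then have "par (mate (par c)) \<noteq> mate (par c)" using tree c by (auto simp: search_tree_def)
      moreover have "mate (par c) \<in> V" using M pV by (simp add: matching_on_def)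
      ultimately have "h a \<le> h (mate (par c))" using pot reach by blast
      then show ?thesis using hm pV by simp
    qed simp
    ultimately show ?thesis using A by blast
  qed
  have "augmentation_state A V (covered V mate) a b par rk h (int (w b)) mate b"
    unfolding augmentation_state_def
    using M hm ne bv av hab reach[of b] tree
    by (auto simp: search_tree_def)
  moreover have "extreme mate'"
    if st: "augmentation_state A V (covered V mate) a b par rk h (int (w b)) mate' a" for mate'
  proof -
    have m': "matching_on A V mate'" "\<forall>v\<in>V. h (mate' v) = h v"
      and cov: "covered V mate' = insert a (insert b (covered V mate))"
      using st by (auto simp: augmentation_state_def)
    have cov': "mate' v \<noteq> v \<longleftrightarrow> v = a \<or> v = b \<or> mate v \<noteq> v" if "v \<in> V" for v
      using cov that by blast
    have "certificate A X Y mate' w k h"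
      unfolding certificate_def
    proof (intro conjI ballI)
      show "x \<in> X \<Longrightarrow> y \<in> Y \<Longrightarrow> A x y \<longrightarrow> h x \<le> h y" for x y
        using cert(1) by (auto simp: certificate_def)
      show "v \<in> X \<union> Y \<Longrightarrow> h (mate' v) = h v" for v
        using m'(2) XY by blast
    next
      fix x assume x: "x \<in> X"
      then have "x \<in> V" "x \<noteq> b" using XY bY disj by blast+
      moreover have "if mate x = x then k - int (w x) \<le> h x else h x \<le> k - int (w x)"
        using cert(1) x by (auto simp: certificate_def)
      ultimately show "if mate' x = x then k - int (w x) \<le> h x else h x \<le> k - int (w x)"
        using cov'[of x] hab k by (auto split: if_splits)
    next
      fix y assume y: "y \<in> Y"
      then have "y \<in> V" "y \<noteq> a" using XY aX disj by blast+
      moreover have "if mate y = y then h y \<le> int (w y) else int (w y) \<le> h y"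
        using cert(1) y by (auto simp: certificate_def)
      ultimately show "if mate' y = y then h y \<le> int (w y) else int (w y) \<le> h y"
        using cov'[of y] hab by (auto split: if_splits)
    qed
    then show ?thesis using m' bip XY by (auto simp: extreme_def)
  qed
  ultimately show ?thesis
    using that[OF ne, of h "int (w b)"] par unfolding hab(1) by blast
qed


lemma run_augment:
  assumes s: "env s" "s ''s'' 0 = a" "s ''cur'' 0 = b" "s ''par'' = par"
    and st: "augmentation_state A V C a b par rk h k (s ''mate'') b"
    and tree: "search_tree A V mate a par rk"
    and ab: "a \<in> V" "a \<notin> C" "a \<noteq> b" "b \<notin> C" "b \<in> V"
    and par: "\<And>b. b \<in> V \<Longrightarrow> par b \<noteq> b \<Longrightarrow> A (par b) b \<and> k \<le> h (par b) \<and> h (par b) \<le> h b \<and> par (par b) = par b"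
  shows "augmentation_state A V C a b par rk h k (run augment s ''mate'') a"
proof -
  \<comment> \<open>Ranks start below \<open>2 * n\<close> and drop with each step, so after
    \<open>2 * l\<close> rounds only the disjunct that the start has been reached can hold.\<close>
  define I where "I i t \<longleftrightarrow> env t \<and> t ''s'' 0 = a \<and> t ''par'' = par \<and>
    augmentation_state A V C a b par rk h k (t ''mate'') (t ''cur'' 0) \<and>
    (t ''cur'' 0 = a \<or> rk (t ''cur'' 0) + i \<le> 2 * n)" for i :: nat and t :: store
  have I_upd: "I i (set_cell ''k'' j t) = I i t" for i j t
    by (simp add: I_def env_upd)
  have AV: "\<And>a b. A a b \<Longrightarrow> a \<in> V \<and> b \<in> V \<and> a \<noteq> b"
    using edge_vertices by auto
  let ?p = "Asg ''x'' (Const 0) (Read ''par'' (cell ''cur'')) ;;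
        Asg ''nxt'' (Const 0) (Read ''mate'' (cell ''x'')) ;;
        Asg ''mate'' (cell ''nxt'') (cell ''nxt'') ;;
        Asg ''mate'' (cell ''x'') (cell ''cur'') ;;
        Asg ''mate'' (cell ''cur'') (cell ''x'') ;;
        Asg ''cur'' (Const 0) (cell ''nxt'')"
  let ?c = "Neq (cell ''cur'') (cell ''s'')"
  have "I (2 * l) (run augment s)"
    unfolding augment_def
  proof (rule run_For)
    show "s ''inlen'' 0 = l" using s by (simp add: env_def)
    have "par b \<noteq> b" using st ab(3) by (auto simp: augmentation_state_def)
    then have "rk b < card (covered V par)" using tree ab(5) by (auto simp: search_tree_def)
    moreover have "card (covered V par) \<le> card V" by (intro card_mono) auto
    ultimately show "I 0 (set_cell ''k'' 0 s)"
      unfolding I_upd using s st by (simp add: I_def)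
  next
    fix i t assume t: "I i t"
    then have env: "env t" and tm: "t ''s'' 0 = a" "t ''par'' = par"
      and st: "augmentation_state A V C a b par rk h k (t ''mate'') (t ''cur'' 0)"
      and rk: "t ''cur'' 0 = a \<or> rk (t ''cur'' 0) + i \<le> 2 * n"
      by (auto simp: I_def)
    have "I (Suc i) (run (Cond ?c ?p Nop) t)"
    proof (cases "bval ?c t")
      case False
      then show ?thesis unfolding run_Cond(2)[OF False] using t tm by (simp add: I_def)
    next
      case True
      define cur where "cur = t ''cur'' 0"
      define nxt where "nxt = t ''mate'' (par cur)"
      have ne: "cur \<noteq> a" using True tm by (simp add: cur_def)
      note step = augmentation_step[OF st[folded cur_def] ne ab symp_A AV par, folded nxt_def]
      define u where "u = run ?p t"
      have "u ''mate'' = (t ''mate'')(nxt := nxt, par cur := cur, cur := par cur)" "u ''cur'' 0 = nxt"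
        "u ''s'' 0 = a" "u ''par'' = par"
        using tm by (simp_all add: u_def nxt_def cur_def)
      moreover have "env u" using env by (simp add: u_def env_upd)
      moreover have "nxt = a \<or> rk nxt + Suc i \<le> 2 * n"
        using step(2) rk ne by (fastforce simp: cur_def)
      ultimately have "I (Suc i) u"
        using step(1) by (simp add: I_def)
      then show ?thesis unfolding run_Cond(1)[OF True] by (simp add: u_def)
    qed
    then show "I (Suc i) (set_cell ''k'' (Suc i) (run (Cond ?c ?p Nop) t))"
      by (simp only: I_upd)
  qed simp_all
  then show ?thesis using n_less by (auto simp: I_def)
qed

definition covered_weight :: "(nat \<Rightarrow> nat) \<Rightarrow> nat" where
  "covered_weight mate = (\<Sum>v\<in>covered V mate. w v)"

definition unaffordable :: "(nat \<Rightarrow> nat) \<Rightarrow> nat \<Rightarrow> bool" where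
  "unaffordable mate r \<longleftrightarrow> (\<forall>(a, b)\<in>augmenting_pairs mate. r < w a + w b)"

lemma run_improve:
  assumes s: "env s" and ex: "extreme (s ''mate'')"
  defines "s' \<equiv> run improve s"
  shows "env s'" and "extreme (s' ''mate'')"
    and "s' ''rem'' 0 + covered_weight (s' ''mate'') = s ''rem'' 0 + covered_weight (s ''mate'')"
    and "unaffordable (s ''mate'') (s ''rem'' 0) \<and> s' ''mate'' = s ''mate'' \<and> s' ''rem'' 0 = s ''rem'' 0 \<or>
      \<not> unaffordable (s ''mate'') (s ''rem'' 0) \<and>
        card (covered V (s' ''mate'')) = card (covered V (s ''mate'')) + 2"
proof -
  let ?mate = "s ''mate''"
  show "env s'" using s by (simp add: s'_def env_run written_improve)
  have M: "matching_on A V ?mate" using ex by (simp add: extreme_def)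
  define u where "u = run find_cheapest s"
  have u: "env u" "u ''mate'' = ?mate" "u ''rem'' = s ''rem''"
    using s by (simp_all add: u_def env_run run_frame written_find_cheapest)
  have uw: "u ''w'' = w" using u(1) by (simp add: env_def)
  have ch: "cheapest_among (augmenting_pairs ?mate) u"
    using run_find_cheapest[OF s M] by (simp add: u_def)
  let ?a = "u ''bs'' 0" and ?b = "u ''be'' 0"
  let ?c = "And (Eq (cell ''found'') (Const 1)) (Not (Less (cell ''rem'') (path_cost ''bs'' ''be'')))"
  let ?p = "Asg ''rem'' (Const 0) (Sub (cell ''rem'') (path_cost ''bs'' ''be'')) ;;
       Asg ''s'' (Const 0) (cell ''bs'') ;; search ;;
       Asg ''cur'' (Const 0) (cell ''be'') ;; augment"
  have s'_eq: "s' = run (Cond ?c ?p Nop) u"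
    by (simp only: s'_def improve_def u_def run.simps(3))
  have c: "bval ?c u \<longleftrightarrow> u ''found'' 0 = 1 \<and> w ?a + w ?b \<le> s ''rem'' 0"
    using u uw by (auto simp: path_cost_def)
  have "extreme (s' ''mate'') \<and>
    s' ''rem'' 0 + covered_weight (s' ''mate'') = s ''rem'' 0 + covered_weight ?mate \<and>
    (unaffordable ?mate (s ''rem'' 0) \<and> s' ''mate'' = ?mate \<and> s' ''rem'' 0 = s ''rem'' 0 \<or>
      \<not> unaffordable ?mate (s ''rem'' 0) \<and> card (covered V (s' ''mate'')) = card (covered V ?mate) + 2)"
  proof (cases "bval ?c u")
    case False
    have "s' = u" unfolding s'_eq run_Cond(2)[OF False] by simp
    moreover have "unaffordable ?mate (s ''rem'' 0)"
      using False ch unfolding c by (fastforce simp: unaffordable_def cheapest_among_def)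
    ultimately show ?thesis using u ex by simp
  next
    case True
    have found: "u ''found'' 0 = 1" and afford: "w ?a + w ?b \<le> s ''rem'' 0" using True unfolding c by auto
    have pair: "(?a, ?b) \<in> augmenting_pairs ?mate"
      and cheap: "\<forall>(a', b')\<in>augmenting_pairs ?mate. w ?a + w ?b \<le> w a' + w b'"
      using ch found u(2) by (auto simp: cheapest_among_def)
    define u1 where "u1 = run (Asg ''rem'' (Const 0) (Sub (cell ''rem'') (path_cost ''bs'' ''be'')) ;;
       Asg ''s'' (Const 0) (cell ''bs'')) u"
    have u1: "env u1" "u1 ''mate'' = ?mate" "u1 ''rem'' 0 = s ''rem'' 0 - (w ?a + w ?b)" "u1 ''s'' 0 = ?a"
      "u1 ''be'' = u ''be''"
      using u uw by (simp_all add: u1_def path_cost_def env_upd)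
    define u2 where "u2 = run search u1"
    define u3 where "u3 = run (Asg ''cur'' (Const 0) (cell ''be'')) u2"
    have u3: "env u3" "u3 ''mate'' = ?mate" "u3 ''rem'' 0 = s ''rem'' 0 - (w ?a + w ?b)" "u3 ''s'' 0 = ?a"
      "u3 ''cur'' 0 = ?b" "u3 ''par'' = u2 ''par''"
      using u1 by (simp_all add: u3_def u2_def env_run env_upd run_frame written_search)
    have s'_u3: "s' = run augment u3"
      unfolding s'_eq run_Cond(1)[OF True] by (simp only: u3_def u2_def u1_def run.simps(3))
    have M': "matching_on A V (u1 ''mate'')" using M u1 by simp
    obtain rk where rk: "search_tree A V ?mate ?a (u2 ''par'') rk"
      and reach: "\<And>b. b \<in> V \<and> u2 ''par'' b \<noteq> b \<longleftrightarrow> b \<in> alt_reach A ?mate ?a"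
      using run_search[OF u1(1) M'] unfolding u2_def u1(2,4) by metis
    obtain h k where ne: "?a \<noteq> ?b"
      and st: "augmentation_state A V (covered V ?mate) ?a ?b (u2 ''par'') rk h k ?mate ?b"
      and par: "\<And>b. b \<in> V \<Longrightarrow> u2 ''par'' b \<noteq> b \<Longrightarrow> A (u2 ''par'' b) b \<and> k \<le> h (u2 ''par'' b) \<and>
        h (u2 ''par'' b) \<le> h b \<and> u2 ''par'' (u2 ''par'' b) = u2 ''par'' b"
      and ext: "\<And>mate'. augmentation_state A V (covered V ?mate) ?a ?b (u2 ''par'') rk h k mate' ?a \<Longrightarrow>
        extreme mate'"
      using extreme_augment[OF ex pair cheap rk reach] by blast
    have ab: "?a \<in> V" "?a \<notin> covered V ?mate" "?b \<notin> covered V ?mate" "?b \<in> V"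
      using pair alt_reach_subset by (auto simp: augmenting_pairs_def)
    have fin: "augmentation_state A V (covered V ?mate) ?a ?b (u2 ''par'') rk h k (s' ''mate'') ?a"
      unfolding s'_u3
      by (rule run_augment[OF u3(1,4,5,6) _ rk ab(1,2) ne ab(3,4) par]) (use st u3(2) in simp_all)
    have cov: "covered V (s' ''mate'') = insert ?a (insert ?b (covered V ?mate))"
      using fin by (simp add: augmentation_state_def)
    have "s' ''rem'' = u3 ''rem''"
      unfolding s'_u3 by (simp add: run_frame written_augment)
    moreover have "covered_weight (s' ''mate'') = w ?a + w ?b + covered_weight ?mate"
      unfolding covered_weight_def cov using ab ne by simp
    ultimately have "s' ''rem'' 0 + covered_weight (s' ''mate'') = s ''rem'' 0 + covered_weight ?mate"
      using u3(3) afford by simp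
    moreover have "card (covered V (s' ''mate'')) = card (covered V ?mate) + 2"
      unfolding cov using ab ne by simp
    moreover have "\<not> unaffordable ?mate (s ''rem'' 0)"
      using pair afford by (fastforce simp: unaffordable_def)
    ultimately show ?thesis using ext[OF fin] by blast
  qed
  then show "extreme (s' ''mate'')"
    and "s' ''rem'' 0 + covered_weight (s' ''mate'') = s ''rem'' 0 + covered_weight ?mate"
    and "unaffordable ?mate (s ''rem'' 0) \<and> s' ''mate'' = ?mate \<and> s' ''rem'' 0 = s ''rem'' 0 \<or>
      \<not> unaffordable ?mate (s ''rem'' 0) \<and> card (covered V (s' ''mate'')) = card (covered V ?mate) + 2"
    by blast+
qed

lemma run_improve_loop:
  assumes s: "env s" and ex: "extreme (s ''mate'')" and "covered V (s ''mate'') = {}"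
  defines "s' \<equiv> run (For ''j'' improve) s"
  shows "extreme (s' ''mate'')" and "unaffordable (s' ''mate'') (s' ''rem'' 0)"
    and "s' ''rem'' 0 + covered_weight (s' ''mate'') = s ''rem'' 0"
proof -
  \<comment> \<open>An affordable round covers two more vertices and an unaffordable one changes
    neither matching nor budget, so the counter forces the first disjunct at the end.\<close>
  define I where "I i t \<longleftrightarrow> env t \<and> extreme (t ''mate'') \<and>
    t ''rem'' 0 + covered_weight (t ''mate'') = s ''rem'' 0 \<and>
    (unaffordable (t ''mate'') (t ''rem'' 0) \<or> i \<le> card (covered V (t ''mate'')))" for i :: nat and t :: store
  have I_upd: "I i (set_cell ''j'' j t) = I i t" for i j t
    by (simp add: I_def env_upd)
  have "I (2 * l) s'"
    unfolding s'_def
  proof (rule run_For)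
    show "s ''inlen'' 0 = l" using s by (simp add: env_def)
    have "covered_weight (s ''mate'') = 0"
      unfolding covered_weight_def assms(3) by simp
    then show "I 0 (set_cell ''j'' 0 s)"
      unfolding I_upd using s ex by (simp add: I_def)
  next
    fix i t assume "I i t"
    then show "I (Suc i) (set_cell ''j'' (Suc i) (run improve t))"
      unfolding I_upd using run_improve[of t] by (auto simp: I_def)
  qed (simp_all add: written_improve)
  moreover have "card (covered V (s' ''mate'')) \<le> card V" by (intro card_mono) auto
  ultimately show "extreme (s' ''mate'')" "unaffordable (s' ''mate'') (s' ''rem'' 0)"
    "s' ''rem'' 0 + covered_weight (s' ''mate'') = s ''rem'' 0"
    using n_less by (auto simp: I_def)
qed

text \<open>With multiplier 0 and zero potential only the bounds at free vertices remain, and they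
  say that weights are nonnegative.\<close>

lemma extreme_empty:
  assumes "bipartition A X Y" "X \<union> Y = V" "\<And>v. v \<in> V \<Longrightarrow> mate v = v"
  shows "extreme mate"
proof -
  have "certificate A X Y mate w 0 (\<lambda>_. 0)"
    using assms by (auto simp: certificate_def)
  then show ?thesis
    using assms by (auto simp: extreme_def matching_on_def)
qed

end

section \<open>Input and output\<close>

lemma run_initialize:
  fixes n m :: nat
  assumes l: "s ''inlen'' 0 = l" and n: "s ''in'' 0 = n" "n \<le> l" and m: "s ''in'' (Suc 0) = m" "m \<le> l"
  defines "s' \<equiv> run initialize s"
  shows "s' ''in'' = s ''in''" "s' ''inlen'' = s ''inlen''" "s' ''rem'' 0 = s ''in'' 2"
    and "e < m \<Longrightarrow> s' ''eu'' e = s ''in'' (3 + n + 2 * e) \<and> s' ''ev'' e = s ''in'' (4 + n + 2 * e)"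
    and "v < n \<Longrightarrow> s' ''eu'' (m + v) = v \<and> s' ''ev'' (m + v) = v + n"
    and "v < n \<Longrightarrow> s' ''w'' v = s ''w'' v \<and> s' ''w'' (v + n) = s ''in'' (3 + v)"
    and "v < 2 * n \<Longrightarrow> s' ''mate'' v = v"
proof -
  define I where "I i t \<longleftrightarrow> t ''in'' = s ''in'' \<and> t ''rem'' 0 = s ''in'' 2 \<and>
    (\<forall>e<m. e < i \<longrightarrow> t ''eu'' e = s ''in'' (3 + n + 2 * e) \<and> t ''ev'' e = s ''in'' (4 + n + 2 * e)) \<and>
    (\<forall>v<n. v + n < i \<longrightarrow> t ''eu'' (m + v) = v \<and> t ''ev'' (m + v) = v + n \<and> t ''w'' (v + n) = s ''in'' (3 + v)) \<and>
    (\<forall>v<n. t ''w'' v = s ''w'' v) \<and>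
    (\<forall>v<2 * n. v < i \<longrightarrow> t ''mate'' v = v)" for i :: nat and t :: store
  have I_upd: "I i (set_cell ''i'' j t) = I i t" for i j t
    by (simp add: I_def)
  define s1 where "s1 = run (Asg ''rem'' (Const 0) (Read ''in'' (Const 2))) s"
  have s1: "s1 ''inlen'' 0 = l" "s1 ''in'' = s ''in''" "s1 ''rem'' 0 = s ''in'' 2" "s1 ''w'' = s ''w''"
    using l by (simp_all add: s1_def)
  let ?in = "\<lambda>k. Read ''in'' (Const k)"
  let ?c1 = "Less (cell ''i'') (?in 1)"
  let ?p1 = "Asg ''eu'' (cell ''i'') (Read ''in'' (Add (Const 3) (Add (?in 0) (Add (cell ''i'') (cell ''i''))))) ;;
          Asg ''ev'' (cell ''i'') (Read ''in'' (Add (Const 4) (Add (?in 0) (Add (cell ''i'') (cell ''i'')))))"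
  let ?p3 = "Asg ''eu'' (Sub (Add (?in 1) (cell ''i'')) (?in 0)) (Sub (cell ''i'') (?in 0)) ;;
             Asg ''ev'' (Sub (Add (?in 1) (cell ''i'')) (?in 0)) (cell ''i'') ;;
             Asg ''w'' (cell ''i'') (Read ''in'' (Sub (Add (Const 3) (cell ''i'')) (?in 0)))"
  let ?p2 = "Asg ''mate'' (cell ''i'') (cell ''i'') ;; Cond (Less (cell ''i'') (?in 0)) Nop ?p3"
  let ?body = "Cond ?c1 ?p1 Nop ;; Cond (Less (cell ''i'') num_vertices) ?p2 Nop"
  have "I (2 * l) (run (For ''i'' ?body) s1)"
  proof (rule run_For)
    show "s1 ''inlen'' 0 = l" by (rule s1)
    show "I 0 (set_cell ''i'' 0 s1)"
      unfolding I_upd using s1 by (simp add: I_def)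
  next
    fix i t assume t: "t ''i'' 0 = i" "I i t"
    define u where "u = run (Cond ?c1 ?p1 Nop) t"
    have tin: "t ''in'' = s ''in''" "t ''rem'' 0 = s ''in'' 2"
      and t_edges: "\<And>e. e < m \<Longrightarrow> e < i \<Longrightarrow> t ''eu'' e = s ''in'' (3 + n + 2 * e) \<and> t ''ev'' e = s ''in'' (4 + n + 2 * e)"
      and t_pend: "\<And>v. v < n \<Longrightarrow> v + n < i \<Longrightarrow>
        t ''eu'' (m + v) = v \<and> t ''ev'' (m + v) = v + n \<and> t ''w'' (v + n) = s ''in'' (3 + v)"
      and t_w: "\<And>v. v < n \<Longrightarrow> t ''w'' v = s ''w'' v"
      and t_mate: "\<And>v. v < 2 * n \<Longrightarrow> v < i \<Longrightarrow> t ''mate'' v = v"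
      using t(2) unfolding I_def by simp_all
    have u: "u ''in'' = s ''in''" "u ''rem'' 0 = s ''in'' 2" "u ''i'' 0 = i" "u ''w'' = t ''w''"
      "u ''mate'' = t ''mate''"
      using t(1) tin by (simp_all add: u_def)
    have u_edges: "u ''eu'' = (if i < m then (t ''eu'')(i := s ''in'' (3 + n + 2 * i)) else t ''eu'')"
      "u ''ev'' = (if i < m then (t ''ev'')(i := s ''in'' (4 + n + 2 * i)) else t ''ev'')"
      using t(1) tin(1) n(1) m(1) by (simp_all add: u_def add.assoc flip: mult_2)
    have c: "aval num_vertices u = 2 * n" using u(1) n(1) by (simp add: num_vertices_def)
    define r where "r = run (Cond (Less (cell ''i'') num_vertices) ?p2 Nop) u"
    have r: "r ''in'' = s ''in''" "r ''rem'' 0 = s ''in'' 2"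
      "r ''mate'' = (if i < 2 * n then (t ''mate'')(i := i) else t ''mate'')"
      "r ''eu'' = (if n \<le> i \<and> i < 2 * n then (u ''eu'')(m + i - n := i - n) else u ''eu'')"
      "r ''ev'' = (if n \<le> i \<and> i < 2 * n then (u ''ev'')(m + i - n := i) else u ''ev'')"
      "r ''w'' = (if n \<le> i \<and> i < 2 * n then (t ''w'')(i := s ''in'' (3 + i - n)) else t ''w'')"
      using u n(1) m(1) c by (cases "i < 2 * n"; cases "i < n"; simp add: r_def)+
    have "I (Suc i) r"
    proof -
      have "r ''eu'' e = s ''in'' (3 + n + 2 * e) \<and> r ''ev'' e = s ''in'' (4 + n + 2 * e)"
        if e: "e < m" "e < Suc i" for e
      proof -
        have "u ''eu'' e = s ''in'' (3 + n + 2 * e) \<and> u ''ev'' e = s ''in'' (4 + n + 2 * e)"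
          using t_edges[of e] e by (cases "e = i") (simp_all add: u_edges)
        moreover have "n \<le> i \<Longrightarrow> e \<noteq> m + i - n" using e by simp
        ultimately show ?thesis by (simp add: r)
      qed
      moreover have "r ''eu'' (m + v) = v \<and> r ''ev'' (m + v) = v + n \<and> r ''w'' (v + n) = s ''in'' (3 + v)"
        if "v < n" "v + n < Suc i" for v
      proof (cases "v + n = i")
        case True
        have i: "n \<le> i" "i < 2 * n" "m + i - n = m + v" "i - n = v" "3 + i - n = 3 + v"
          using True that by auto
        have "r ''eu'' (m + v) = v" "r ''ev'' (m + v) = v + n" "r ''w'' (v + n) = s ''in'' (3 + v)"
          unfolding r i using i(1,2) True by auto
        then show ?thesis by blast
      next
        case False
        then have vi: "v + n < i" using that by simp
        then have "t ''eu'' (m + v) = v \<and> t ''ev'' (m + v) = v + n \<and> t ''w'' (v + n) = s ''in'' (3 + v)"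
          using t_pend that(1) by blast
        moreover have "m + v \<noteq> m + i - n" "v + n \<noteq> i" "i < m \<Longrightarrow> m + v \<noteq> i" using vi by auto
        ultimately show ?thesis by (simp add: r u_edges)
      qed
      moreover have "r ''w'' v = s ''w'' v" if "v < n" for v
        using that t_w by (simp add: r)
      moreover have "r ''mate'' v = v" if "v < 2 * n" "v < Suc i" for v
        using that t_mate[of v] by (cases "v = i") (simp_all add: r)
      ultimately show ?thesis using r(1,2) by (simp add: I_def)
    qed
    then show "I (Suc i) (set_cell ''i'' (Suc i) (run ?body t))"
      unfolding I_upd by (simp only: r_def u_def run.simps(3))
  qed simp_all
  then have I: "I (2 * l) s'"
    by (simp only: s'_def initialize_def s1_def run.simps(3))
  have "written initialize = {''rem'', ''i'', ''eu'', ''ev'', ''mate'', ''w''}"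
    by (auto simp: initialize_def)
  then show "s' ''inlen'' = s ''inlen''" by (simp add: s'_def run_frame)
  show "s' ''in'' = s ''in''" "s' ''rem'' 0 = s ''in'' 2"
    "e < m \<Longrightarrow> s' ''eu'' e = s ''in'' (3 + n + 2 * e) \<and> s' ''ev'' e = s ''in'' (4 + n + 2 * e)"
    "v < n \<Longrightarrow> s' ''eu'' (m + v) = v \<and> s' ''ev'' (m + v) = v + n"
    "v < n \<Longrightarrow> s' ''w'' v = s ''w'' v \<and> s' ''w'' (v + n) = s ''in'' (3 + v)"
    "v < 2 * n \<Longrightarrow> s' ''mate'' v = v"
    using I n m by (simp_all add: I_def)
qed

lemma output_write_output:
  assumes l: "s ''inlen'' 0 = l" and n: "s ''in'' 0 = n" "n \<le> l"
  shows "output_of (run write_output s) = filter (\<lambda>v. v < n \<and> s ''mate'' v = v + n) [0..<2 * l]"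
proof -
  let ?P = "\<lambda>v. v < n \<and> s ''mate'' v = v + n"
  define L where "L i = filter ?P [0..<i]" for i
  have L_Suc: "L (Suc i) = (if ?P i then L i @ [i] else L i)" for i
    by (simp add: L_def)
  have len_L: "length (L i) \<le> n" for i
  proof -
    have "distinct (L i)" by (simp add: L_def)
    then have "length (L i) = card (set (L i))" by (simp only: distinct_card)
    also have "\<dots> \<le> card {..<n}" by (intro card_mono) (auto simp: L_def)
    finally show ?thesis by simp
  qed
  define I where "I i t \<longleftrightarrow> t ''in'' = s ''in'' \<and> t ''inlen'' = s ''inlen'' \<and> t ''mate'' = s ''mate'' \<and>
    t ''d'' 0 = l - length (L i) \<and> map (t ''out'') [0..<length (L i)] = L i" for i :: nat and t :: store
  have I_upd: "I i (set_cell ''i'' j t) = I i t" for i j t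
    by (simp add: I_def)
  define s1 where "s1 = run (Asg ''d'' (Const 0) (cell ''inlen'')) s"
  let ?c = "And (Less (cell ''i'') (Read ''in'' (Const 0)))
         (Eq (Read ''mate'' (cell ''i'')) (Add (cell ''i'') (Read ''in'' (Const 0))))"
  let ?p = "Asg ''out'' (Sub (cell ''inlen'') (cell ''d'')) (cell ''i'') ;;
        Asg ''d'' (Const 0) (Sub (cell ''d'') (Const 1))"
  define s2 where "s2 = run (For ''i'' (Cond ?c ?p Nop)) s1"
  have "I (2 * l) s2"
    unfolding s2_def
  proof (rule run_For)
    show "s1 ''inlen'' 0 = l" using l by (simp add: s1_def)
    show "I 0 (set_cell ''i'' 0 s1)"
      unfolding I_upd using l by (simp add: I_def s1_def L_def)
  next
    fix i t assume t: "t ''i'' 0 = i" "I i t"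
    have c: "bval ?c t \<longleftrightarrow> ?P i" using t n by (auto simp: I_def)
    have "I (Suc i) (run (Cond ?c ?p Nop) t)"
    proof (cases "bval ?c t")
      case False
      then show ?thesis
        unfolding run_Cond(2)[OF False] using t(2) unfolding c by (auto simp: I_def L_Suc)
    next
      case True
      define u where "u = run ?p t"
      have Li: "L (Suc i) = L i @ [i]" using True unfolding c L_Suc by simp
      have "length (L i) < l" using len_L[of "Suc i"] n(2) by (simp add: Li)
      then have addr: "l - t ''d'' 0 = length (L i)" using t(2) by (simp add: I_def)
      have "u ''out'' = (t ''out'')(length (L i) := i)" "u ''d'' 0 = t ''d'' 0 - 1"
        "u ''in'' = s ''in''" "u ''inlen'' = s ''inlen''" "u ''mate'' = s ''mate''"
        using t l addr by (auto simp: u_def I_def)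
      then have "I (Suc i) u" using t(2) by (simp add: I_def Li)
      then show ?thesis unfolding run_Cond(1)[OF True] by (simp add: u_def)
    qed
    then show "I (Suc i) (set_cell ''i'' (Suc i) (run (Cond ?c ?p Nop) t))"
      by (simp only: I_upd)
  qed simp_all
  moreover have "run write_output s = run (Asg ''outlen'' (Const 0) (Sub (cell ''inlen'') (cell ''d''))) s2"
    by (simp only: write_output_def s1_def s2_def run.simps(3))
  moreover have "length (L (2 * l)) \<le> l" using len_L[of "2 * l"] n(2) by simp
  ultimately show ?thesis
    using l by (simp add: I_def output_of_def L_def)
qed

section \<open>Reading the encoding and assembling the result\<close>

lemma length_concat_pairs: "length (concat (map (\<lambda>(u, v). [u, v]) es)) = 2 * length es"
  by (induction es) auto

lemma nth_concat_pairs: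
  "e < length es \<Longrightarrow> concat (map (\<lambda>(u, v). [u, v]) es) ! (2 * e) = fst (es ! e) \<and>
     concat (map (\<lambda>(u, v). [u, v]) es) ! Suc (2 * e) = snd (es ! e)"
proof (induction es arbitrary: e)
  case (Cons p es)
  then show ?case by (cases e) (auto split: prod.splits)
qed simp

lemma store_bounded_initial_store: "store_bounded (input_size xs) (initial_store xs)"
  and length_le_input_size: "length xs \<le> input_size xs"
proof -
  have "1 \<le> bin_length x" for x by (simp add: bin_length_def)
  then have "(\<Sum>x\<leftarrow>xs. 1) \<le> input_size xs"
    unfolding input_size_def by (intro sum_list_mono) auto
  then show len: "length xs \<le> input_size xs" by (simp add: sum_list_triv)
  have "x \<le> 2 ^ Suc (input_size xs)" if "x \<in> set xs" for x
  proof -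
    have "bin_length x \<le> input_size xs"
      unfolding input_size_def using that by (intro member_le_sum_list) auto
    then have "2 ^ bin_length x \<le> (2::nat) ^ Suc (input_size xs)"
      by (intro power_increasing) auto
    then show ?thesis using less_two_power_bin_length[of x] by linarith
  qed
  moreover have "length xs \<le> 2 ^ Suc (input_size xs)"
    using len less_exp[of "input_size xs"] unfolding power_Suc by linarith
  ultimately show "store_bounded (input_size xs) (initial_store xs)"
    by (auto simp: store_bounded_def initial_store_def)
qed

text \<open>Bridges the weight array of the store and \<open>pendant_weight\<close>, which are shown
  to agree only on the vertices.\<close>

lemma certificate_cong:
  assumes "\<And>v. v \<in> X \<union> Y \<Longrightarrow> w v = w' v"
  shows "certificate A X Y mate w l h \<longleftrightarrow> certificate A X Y mate w' l h"
  using assms by (auto simp: certificate_def)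

lemma interdict_correct:
  assumes bip: "bipartite {..<n} E" and enc: "encodes_instance xs n E c B"
  defines "ys \<equiv> output_of (run interdict (initial_store xs))"
  shows "distinct ys \<and> optimal_interdiction_set {..<n} E c B (set ys)"
proof -
  obtain es where es: "set (map (\<lambda>(u, v). {u, v}) es) = E"
    and xs: "xs = [n, length es, B] @ map c [0..<n] @ concat (map (\<lambda>(u, v). [u, v]) es)"
    using enc by (auto simp: encodes_instance_def)
  define m l s where "m = length es" and "l = length xs" and "s = initial_store xs"
  have l: "l = 3 + n + 2 * m"
    unfolding l_def m_def xs length_append length_concat_pairs by simp
  have inp: "s ''in'' i = xs ! i" if "i < l" for i
    using that by (simp add: s_def initial_store_def l_def)
  have "s ''inlen'' 0 = l" by (simp add: s_def initial_store_def l_def)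
  moreover have "s ''in'' 0 = n" "s ''in'' (Suc 0) = m" "s ''in'' 2 = B"
    using inp[of 0] inp[of 1] inp[of 2] xs by (simp_all add: l m_def)
  ultimately have s: "s ''inlen'' 0 = l" "s ''in'' 0 = n" "s ''in'' (Suc 0) = m" "s ''in'' 2 = B"
    by blast+
  have in_c: "s ''in'' (3 + v) = c v" if "v < n" for v
    using inp[of "3 + v"] that xs by (simp add: l nth_append)
  have in_e: "s ''in'' (3 + n + 2 * e) = fst (es ! e)" "s ''in'' (4 + n + 2 * e) = snd (es ! e)"
    if "e < m" for e
    using inp[of "3 + n + 2 * e"] inp[of "4 + n + 2 * e"] that xs nth_concat_pairs[of e es]
    by (simp_all add: l m_def nth_append)
  have nm: "n \<le> l" "m \<le> l" using l by auto
  define s1 where "s1 = run initialize s"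
  note init = run_initialize[OF s(1,2) nm(1) s(3) nm(2), folded s1_def]
  let ?A = "pendant_adj n E"
  define eu ev w where "eu = s1 ''eu''" and "ev = s1 ''ev''" and "w = s1 ''w''"
  have G: "simple_graph {..<n} E" using bip by (simp add: bipartite_def)
  have edges: "eu e < n \<and> ev e < n \<and> {eu e, ev e} \<in> E" if "e < m" for e
  proof -
    have "es ! e \<in> set es" using that by (simp add: m_def)
    then have "{fst (es ! e), snd (es ! e)} \<in> E"
      unfolding es[symmetric] set_map by (rule rev_image_eqI) (simp add: case_prod_beta)
    then have "{eu e, ev e} \<in> E"
      using init(4)[OF that] in_e[OF that] by (simp add: eu_def ev_def)
    then show ?thesis using G by (auto simp: simple_graph_def)
  qed
  have pend: "eu (m + v) = v \<and> ev (m + v) = v + n" if "v < n" for v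
    using init(5)[OF that] by (simp add: eu_def ev_def)
  have edge_ex: "\<exists>e<m. u = eu e \<and> v = ev e \<or> u = ev e \<and> v = eu e" if "{u, v} \<in> E" for u v
  proof -
    have "{u, v} \<in> (\<lambda>(u, v). {u, v}) ` set es"
      using that unfolding es[symmetric] set_map .
    then obtain p where p: "p \<in> set es" "{u, v} = (case p of (u, v) \<Rightarrow> {u, v})"
      by (rule imageE)
    then obtain e where "e < m" "es ! e = p"
      unfolding m_def in_set_conv_nth by blast
    then have e: "e < m" "{u, v} = {fst (es ! e), snd (es ! e)}"
      using p(2) by (simp_all add: case_prod_beta)
    then have "{u, v} = {eu e, ev e}"
      using init(4)[OF e(1)] in_e[OF e(1)] by (simp add: eu_def ev_def)
    then show ?thesis using e(1) by (auto simp: doubleton_eq_iff)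
  qed
  obtain X Y where XY: "bipartition ?A X Y" "X \<union> Y = {..<2 * n}"
    using bipartition_pendant_adj[OF bip] .
  interpret network n m l eu ev w ?A
  proof
    show "n < l" "n + m \<le> l" using l by auto
    show "?A a b \<longleftrightarrow> (\<exists>e<n + m. a = eu e \<and> b = ev e \<or> a = ev e \<and> b = eu e)" for a b
    proof
      assume "?A a b"
      then consider "{a, b} \<in> E" | "a < n" "b = a + n" | "b < n" "a = b + n"
        by (auto simp: pendant_adj_def)
      then show "\<exists>e<n + m. a = eu e \<and> b = ev e \<or> a = ev e \<and> b = eu e"
      proof cases
        case 1
        then show ?thesis using edge_ex by (meson trans_less_add2)
      next
        case 2
        then show ?thesis using pend[of a] by (intro exI[of _ "m + a"]) auto
      next
        case 3
        then show ?thesis using pend[of b] by (intro exI[of _ "m + b"]) auto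
      qed
    next
      assume "\<exists>e<n + m. a = eu e \<and> b = ev e \<or> a = ev e \<and> b = eu e"
      then obtain e where e: "e < n + m" "a = eu e \<and> b = ev e \<or> a = ev e \<and> b = eu e" by blast
      show "?A a b"
      proof (cases "e < m")
        case True
        then show ?thesis using e edges[of e] by (auto simp: pendant_adj_def insert_commute)
      next
        case False
        then have "e = m + (e - m)" "e - m < n" using e by auto
        then show ?thesis using e pend[of "e - m"] by (auto simp: pendant_adj_def)
      qed
    qed
    show "a < 2 * n \<and> b < 2 * n \<and> a \<noteq> b" if "?A a b" for a b
      using that XY unfolding bipartition_def by blast
  qed
  have env: "env s1"
    unfolding env_def using init(1,2) s by (simp add: eu_def ev_def w_def)
  have ex: "extreme (s1 ''mate'')"
    using extreme_empty[OF XY] init(7) by simp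
  have "covered {..<2 * n} (s1 ''mate'') = {}" using init(7) by auto
  note loop = run_improve_loop[OF env ex this]
  define s2 where "s2 = run (For ''j'' improve) s1"
  let ?mate = "s2 ''mate''"
  let ?r = "s2 ''rem'' 0"
  have w: "w v = pendant_weight n c v" if "v < 2 * n" for v
  proof (cases "v < n")
    case True
    then show ?thesis using init(6)[OF True] by (simp add: w_def pendant_weight_def s_def initial_store_def)
  next
    case False
    then have "v - n < n" "v = v - n + n" using that by auto
    then show ?thesis using init(6)[of "v - n"] in_c[of "v - n"] False
      by (simp add: w_def pendant_weight_def)
  qed
  have M: "matching_on ?A {..<2 * n} ?mate" and r: "?r + covered_weight ?mate = B"
    using loop s init(3) by (simp_all add: extreme_def s2_def)
  have "covered_weight ?mate = (\<Sum>v\<in>covered {..<2 * n} ?mate. pendant_weight n c v)"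
    unfolding covered_weight_def using w by (intro sum.cong) auto
  then have cost: "covered_weight ?mate = (\<Sum>v\<in>interdicted n ?mate. c v)"
    using interdicted_cost[OF M] by simp
  \<comment> \<open>No augmenting pair is affordable, so by integrality each costs at least one more
    than the remaining budget. The multiplier can be raised to that value, which gives the strict
    inequality needed for optimality.\<close>
  have "\<forall>(a, b)\<in>augmenting_pairs ?mate. int (Suc ?r) \<le> int (w a + w b)"
    using loop(2) by (auto simp: unaffordable_def s2_def)
  then obtain X' Y' k h where h: "bipartition ?A X' Y'" "X' \<union> Y' = {..<2 * n}"
    "certificate ?A X' Y' ?mate w k h" "int (Suc ?r) \<le> k"
    using extreme_raise[OF loop(1)[folded s2_def]] by metis
  have "certificate ?A X' Y' ?mate (pendant_weight n c) k h"
    using certificate_cong[of X' Y' w "pendant_weight n c"] h w by auto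
  moreover have "(\<Sum>v\<in>interdicted n ?mate. c v) \<le> B" "int B < int (\<Sum>v\<in>interdicted n ?mate. c v) + k"
    using r h(4) unfolding cost by linarith+
  ultimately have opt: "optimal_interdiction_set {..<n} E c B (interdicted n ?mate)"
    using certificate_imp_optimal[OF G h(1,2) M] by blast
  have "s2 ''inlen'' = s1 ''inlen''" "s2 ''in'' = s1 ''in''"
    unfolding s2_def by (rule run_frame, simp add: written_improve)+
  then have "s2 ''inlen'' 0 = l" "s2 ''in'' 0 = n"
    using init(1,2) s by simp_all
  then have "ys = filter (\<lambda>v. v < n \<and> ?mate v = v + n) [0..<2 * l]"
    using output_write_output[of s2 l n] nm
    by (simp only: ys_def interdict_def s_def[symmetric] s1_def[symmetric] s2_def[symmetric] run.simps(3))
  moreover from this have "set ys = interdicted n ?mate"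
    using l by (auto simp: interdicted_def)
  ultimately show ?thesis using opt by simp
qed

theorem theorem8:
  shows "\<exists>(p :: com) (q :: nat poly).
    \<forall>(n :: nat) (E :: nat set set) (c :: nat \<Rightarrow> nat) (B :: nat) (xs :: nat list).
      bipartite {..<n} E \<longrightarrow> (\<forall>v<n. c v > 0) \<longrightarrow> B > 0 \<longrightarrow>
      encodes_instance xs n E c B \<longrightarrow>
      (\<exists>ys t. computes_in_time p xs ys t \<and> t \<le> poly q (input_size xs) \<and>
         distinct ys \<and> optimal_interdiction_set {..<n} E c B (set ys))"
proof (intro exI[of _ "compile interdict"] exI[of _ "time_poly interdict"] allI impI)
  fix n E c B xs
  assume bip: "bipartite {..<n} E" and enc: "encodes_instance xs n E c B"
  let ?s = "initial_store xs"
  have "?s ''inlen'' 0 \<le> input_size xs"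
    using length_le_input_size[of xs] by (simp add: initial_store_def)
  then obtain t where "exec (compile interdict) ?s t (run interdict ?s)"
    "t \<le> poly (time_poly interdict) (input_size xs)"
    using run_exec[OF well_formed_interdict store_bounded_initial_store] by blast
  then show "\<exists>ys t. computes_in_time (compile interdict) xs ys t \<and>
      t \<le> poly (time_poly interdict) (input_size xs) \<and>
      distinct ys \<and> optimal_interdiction_set {..<n} E c B (set ys)"
    using interdict_correct[OF bip enc] by (auto simp: computes_in_time_def)
qed

end
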